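(* Let $N\ge 1$, $\ell,m\in\{0,1,2,\dots\}$, and let $G$ be an admissible kernel of order $\ell+m$ with parameters $d>\ell+m$, $L>0$ and $T_*\in(0,\infty]$ (as defined in the context). Let $0<\theta<2$ be such that $\theta\le\min\{d,L\}$, let $P_\theta=P_\theta(x,t)$ be the fundamental solution of the fractional heat equation $\partial_t u+(-\Delta)^{\theta/2}u=0$ in $\mathbb{R}^N\times(0,\infty)$, and set $$K_\theta(x,t):=P_\theta\left(x,t^{\theta/d}\right),\qquad x\in\mathbb{R}^N,\ t>0.$$ Then: (a) For any $j\in\{0,\dots,\ell+m\}$ there exists $c_j>0$ such that $$|\nabla_x^j G(x,y,t)|\le c_j\,t^{-\frac{j}{d}}K_\theta(x-y,t),\qquad x,y\in\mathbb{R}^N,\ t\in(0,T_* ).$$ (b) There exists $C_*>0$ such that $$\int_{\mathbb{R}^N}K_\theta(x-y,t-s)K_\theta(y,s)\,dy\le C_*K_\theta(x,t),\qquad x\in\mathbb{R}^N,\ 0<s<t.$$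
   Context: Admissible kernel of order $\ell+m$ with parameters $d>\ell+m$, $L>0$, $T_*\in(0,\infty]$: a real function $G=G(x,y,t)$ such that (i) $G\in C^{\ell+m}(\mathbb{R}^{2N}\times(0,T_* ))$; (ii) there exists $C_G>0$ such that $|\nabla_x^jG(x,y,t)|\le C_G\,t^{-\frac{N+j}{d}}\bigl(1+t^{-\frac1d}|x-y|\bigr)^{-N-L-j}$ for all $(x,y,t)\in\mathbb{R}^{2N}\times(0,T_* )$ and $j\in\{0,\dots,\ell+m\}$; (iii) $G(x,z,t)=\int_{\mathbb{R}^N}G(x,y,t-s)G(y,z,s)\,dy$ for $x,z\in\mathbb{R}^N$ and $0<s<t<T_*$. Here $\nabla_x^j$ denotes the collection of all $j$-th order partial derivatives in $x$. The fundamental solution is $P_\theta(x,t)=(2\pi)^{-N}\int_{\mathbb{R}^N}e^{ix\cdot\xi}e^{-t|\xi|^\theta}\,d\xi$, which satisfies $\int_{\mathbb{R}^N}P_\theta(x,t)\,dx=1$. *)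

theory Defs
  imports "HOL-Analysis.Analysis"
begin

definition partial_deriv :: "'a::euclidean_space \<Rightarrow> ('a \<Rightarrow> real) \<Rightarrow> 'a \<Rightarrow> real" where
  "partial_deriv b f x = deriv (\<lambda>h. f (x + h *\<^sub>R b)) 0"

definition iter_partial :: "'a::euclidean_space list \<Rightarrow> ('a \<Rightarrow> real) \<Rightarrow> 'a \<Rightarrow> real" where
  "iter_partial bs f = foldr partial_deriv bs f"

text \<open>\<open>C\<^sup>k\<close> on \<open>U\<close> (meant for open \<open>U\<close>): all partial derivatives of order at most \<open>k\<close> exist and are
  continuous on \<open>U\<close>. Existence is demanded separately because \<^const>\<open>deriv\<close> is total.\<close>

definition Ck_on :: "nat \<Rightarrow> 'a::euclidean_space set \<Rightarrow> ('a \<Rightarrow> real) \<Rightarrow> bool" where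
  "Ck_on k U f \<longleftrightarrow>
     (\<forall>bs. set bs \<subseteq> Basis \<and> length bs < k \<longrightarrow>
        (\<forall>b\<in>Basis. \<forall>x\<in>U. (\<lambda>h::real. iter_partial bs f (x + h *\<^sub>R b)) differentiable (at 0))) \<and>
     (\<forall>bs. set bs \<subseteq> Basis \<and> length bs \<le> k \<longrightarrow> continuous_on U (iter_partial bs f))"

text \<open>The Euclidean norm of the family of all \<open>j\<close>-th order partial derivatives of \<open>f\<close> at \<open>x\<close>, indexed
  by \<open>j\<close>-tuples of coordinate directions.\<close>

definition norm_grad :: "nat \<Rightarrow> ('a::euclidean_space \<Rightarrow> real) \<Rightarrow> 'a \<Rightarrow> real" where
  "norm_grad j f x =
     L2_set (\<lambda>bs. iter_partial bs f x) {bs. set bs \<subseteq> Basis \<and> length bs = j}"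

text \<open>The parameter \<open>k\<close> is the order and \<open>T\<close> is the existence time, which may be \<open>\<infinity>\<close>. The integrand in
  the last clause is integrable by the first two clauses when \<open>L > 0\<close>.\<close>

definition admissible_kernel ::
    "nat \<Rightarrow> real \<Rightarrow> real \<Rightarrow> ereal \<Rightarrow> ('a::euclidean_space \<Rightarrow> 'a \<Rightarrow> real \<Rightarrow> real) \<Rightarrow> bool" where
  "admissible_kernel k d L T G \<longleftrightarrow>
     Ck_on k {(x, y, t). 0 < t \<and> ereal t < T} (\<lambda>(x, y, t). G x y t) \<and>
     (\<exists>C>0. \<forall>x y t. \<forall>j\<le>k. 0 < t \<and> ereal t < T \<longrightarrow>
        norm_grad j (\<lambda>x. G x y t) x
          \<le> C * t powr (- ((real DIM('a) + real j) / d))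
              * (1 + t powr (- (1 / d)) * norm (x - y)) powr (- real DIM('a) - L - real j)) \<and>
     (\<forall>x z s t. 0 < s \<and> s < t \<and> ereal t < T \<longrightarrow>
        G x z t = (LINT y|lborel. G x y (t - s) * G y z s))"

definition fourier_heat :: "real \<Rightarrow> 'a::euclidean_space \<Rightarrow> real \<Rightarrow> complex" where
  "fourier_heat \<theta> x t =
     (LINT \<xi>|lborel. exp (\<i> * complex_of_real (x \<bullet> \<xi>)) * complex_of_real (exp (- t * norm \<xi> powr \<theta>)))"

text \<open>The fundamental solution of \<open>\<partial>\<^sub>t u + (-\<Delta>)\<^bsup>\<theta>/2\<^esup> u = 0\<close>. The Fourier integral is real (see
  \<open>fourier_heat_real\<close> below), so taking the real part only changes the type.\<close>

definition P_frac :: "real \<Rightarrow> 'a::euclidean_space \<Rightarrow> real \<Rightarrow> real" where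
  "P_frac \<theta> x t = Re (fourier_heat \<theta> x t) / (2 * pi) ^ DIM('a)"

lemma fourier_heat_real: "complex_of_real (Re (fourier_heat \<theta> x t)) = fourier_heat \<theta> x t"
proof -
  have uminus: "(LINT \<xi>|lborel. f (- \<xi>)) = (LINT \<xi>|lborel. f \<xi>)"
    if "f \<in> borel_measurable borel" for f :: "'a \<Rightarrow> complex"
  proof -
    have "distr lborel borel (\<lambda>\<xi>::'a. - \<xi>) = lborel"
      using lborel_affine_euclidean[of "\<lambda>_. -1" "0::'a"]
      by (simp add: sum_negf euclidean_representation density_1)
    then have "(LINT \<xi>|lborel. f \<xi>) = (LINT \<xi>|distr lborel borel (\<lambda>\<xi>::'a. - \<xi>). f \<xi>)"
      by simp
    also have "\<dots> = (LINT \<xi>|lborel. f (- \<xi>))"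
      by (rule integral_distr) (use that in auto)
    finally show ?thesis by simp
  qed
  let ?f = "\<lambda>\<xi>. exp (\<i> * complex_of_real (x \<bullet> \<xi>)) * complex_of_real (exp (- t * norm \<xi> powr \<theta>))"
  have "cnj (fourier_heat \<theta> x t) = (LINT \<xi>|lborel. cnj (?f \<xi>))"
    by (simp only: fourier_heat_def Bochner_Integration.integral_cnj)
  also have "\<dots> = (LINT \<xi>|lborel. ?f (- \<xi>))"
    by (simp add: exp_cnj)
  also have "\<dots> = fourier_heat \<theta> x t"
    unfolding fourier_heat_def by (rule uminus) measurable
  finally show ?thesis
    by (simp add: complex_eq_iff)
qed

definition K_frac :: "real \<Rightarrow> real \<Rightarrow> 'a::euclidean_space \<Rightarrow> real \<Rightarrow> real" where
  "K_frac \<theta> d x t = P_frac \<theta> x (t powr (\<theta> / d))"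

end

theory Submission
  imports Defs "HOL-Probability.Characteristic_Functions" "HOL-Real_Asymp.Real_Asymp"
begin

text \<open>
  Everything rests on the two-sided bound \<open>P\<^sub>\<theta>(x, 1) \<approx> (1 + |x|)\<^bsup>-N-\<theta>\<^esup>\<close>, which is subordination without the
  subordinator. With \<open>\<alpha> = \<theta>/2 < 1\<close> the function \<open>exp(-\<lambda>\<^sup>\<alpha>)\<close> is a limit of positive combinations of the
  exponentials \<open>exp(-s\<lambda>)\<close>, so every linear inequality between the Gaussians \<open>g\<^sub>s(x)\<close>, the Fourier transforms of
  \<open>exp(-s|\<xi>|\<^sup>2)\<close>, and the numbers \<open>exp(-s\<lambda>)\<close>, valid for all \<open>s > 0\<close>, is inherited by \<open>P\<^sub>\<theta>(x, 1)\<close> and the numbers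
  \<open>exp(-\<lambda>\<^sup>\<alpha>)\<close>. The upper bound comes from \<open>g\<^sub>s(x) \<le> C |x|\<^bsup>-N\<^esup> (1 - exp(-s/|x|\<^sup>2))\<close>, which gives
  \<open>P\<^sub>\<theta>(x, 1) \<le> C |x|\<^bsup>-N\<^esup> (1 - exp(-|x|\<^bsup>-\<theta>\<^esup>))\<close>. For the lower bound, \<open>1 - exp(-u)\<close> is at most a multiple of the Gaussian
  profile at \<open>u\<close> plus \<open>2\<delta>(1 - exp(-u/\<delta>)) + 2(1 - exp(-u/A))\<close>, and for small \<open>\<delta>\<close> and large \<open>A\<close> these last terms are
  absorbed, again because \<open>0 < \<alpha> < 1\<close>.

  By scaling, \<open>K\<^sub>\<theta>(x, t)\<close> is comparable to \<open>h\<^sub>r(x) = r\<^bsup>-N\<^esup> (1 + |x|/r)\<^bsup>-N-\<theta>\<^esup>\<close> with \<open>r = t\<^bsup>1/d\<^esup>\<close>, and the kernel bound follows.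
  The convolution bound uses the pointwise inequality \<open>h\<^sub>r(u) h\<^sub>q(v) \<le> M h\<^sub>R(u + v) (h\<^sub>r(u) + h\<^sub>q(v))\<close>, valid if
  \<open>r, q \<le> R\<close> and one of \<open>r, q\<close> is comparable to \<open>R\<close>.
\<close>

section \<open>Integrals over Euclidean space\<close>

text \<open>\<open>lborel\<close> on the whole space is the image of the product of one-dimensional
  Lebesgue measures under the map from coordinates to vectors, so both claims reduce to Fubini on
  the product.\<close>

lemma product_lborel:
  fixes f :: "'a::euclidean_space \<Rightarrow> real \<Rightarrow> 'b::{real_normed_field,banach,second_countable_topology}"
  assumes int: "\<And>b. b \<in> Basis \<Longrightarrow> integrable lborel (f b)"
  shows integrable_lborel_prod: "integrable lborel (\<lambda>x::'a. \<Prod>b\<in>Basis. f b (x \<bullet> b))"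
    and integral_lborel_prod:
      "(LINT x|lborel. (\<Prod>b\<in>Basis. f b ((x::'a) \<bullet> b))) = (\<Prod>b\<in>Basis. (LINT u|lborel. f b u))"
proof -
  interpret product_sigma_finite "\<lambda>_::'a. lborel :: real measure" ..
  let ?T = "\<lambda>g. \<Sum>b\<in>Basis. g b *\<^sub>R (b::'a)"
  have meas: "f b \<in> borel_measurable borel" if "b \<in> Basis" for b
    using borel_measurable_integrable[OF int[OF that]] by simp
  have m: "(\<lambda>x::'a. \<Prod>b\<in>Basis. f b (x \<bullet> b)) \<in> borel_measurable borel"
    by (intro borel_measurable_prod measurable_compose[OF _ meas]) auto
  have T: "?T \<in> measurable (\<Pi>\<^sub>M b\<in>Basis. lborel) borel"
    by measurable
  have eq: "(\<Prod>b\<in>Basis. f b (?T g \<bullet> b)) = (\<Prod>b\<in>Basis. f b (g b))" for g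
    by (intro prod.cong) auto
  show "integrable lborel (\<lambda>x::'a. \<Prod>b\<in>Basis. f b (x \<bullet> b))"
    apply (subst lborel_eq)
    apply (subst integrable_distr_eq[OF T m])
    unfolding eq by (intro product_integrable_prod int) auto
  show "(LINT x|lborel. (\<Prod>b\<in>Basis. f b ((x::'a) \<bullet> b))) = (\<Prod>b\<in>Basis. (LINT u|lborel. f b u))"
    apply (subst lborel_eq)
    apply (subst integral_distr[OF T m])
    unfolding eq by (intro product_integral_prod int) auto
qed

lemma integral_lborel_affine:
  fixes f :: "'a::euclidean_space \<Rightarrow> 'b::{banach,second_countable_topology}"
  assumes "f \<in> borel_measurable borel" "c \<noteq> 0"
  shows "integral\<^sup>L lborel f = \<bar>c\<bar> ^ DIM('a) *\<^sub>R (LINT x|lborel. f (t + c *\<^sub>R x))"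
  using assms by (subst lborel_affine[of c t]) (simp_all add: integral_density integral_distr)

lemma integrable_lborel_affine:
  fixes f :: "'a::euclidean_space \<Rightarrow> 'b::{banach,second_countable_topology}"
  assumes "integrable lborel f" "c \<noteq> 0"
  shows "integrable lborel (\<lambda>x. f (t + c *\<^sub>R x))"
proof -
  have [measurable]: "f \<in> borel_measurable borel"
    using borel_measurable_integrable[OF assms(1)] by simp
  have "integrable (density (distr lborel borel (\<lambda>x. t + c *\<^sub>R x)) (\<lambda>_. \<bar>c\<bar> ^ DIM('a))) f"
    using assms lborel_affine[of c t] by simp
  then have "integrable lborel (\<lambda>x. \<bar>c\<bar> ^ DIM('a) *\<^sub>R f (t + c *\<^sub>R x))"
    by (subst (asm) integrable_density) (auto simp: integrable_distr_eq)
  then have "integrable lborel (\<lambda>x. (1 / \<bar>c\<bar> ^ DIM('a)) *\<^sub>R (\<bar>c\<bar> ^ DIM('a) *\<^sub>R f (t + c *\<^sub>R x)))"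
    by (rule integrable_scaleR_right)
  then show ?thesis
    using assms(2) by simp
qed

section \<open>Integrability of polynomially decaying weights\<close>

lemma integrable_bracket_real:
  fixes e :: real
  assumes "e > 0"
  shows "integrable lborel (\<lambda>u::real. (1 + \<bar>u\<bar>) powr (- 1 - e))"
proof -
  let ?f = "\<lambda>u::real. (1 + \<bar>u\<bar>) powr (- 1 - e) * indicator {0..} u"
  have "(\<integral>\<^sup>+ u. ennreal ((1 + u) powr (- 1 - e)) * indicator {0..} u \<partial>lborel)
          = ennreal (0 - (- ((1 + 0) powr (- e)) / e))"
  proof (rule nn_integral_FTC_atLeast)
    show "((\<lambda>u. - ((1 + u) powr (- e)) / e) \<longlongrightarrow> 0) at_top"
      using assms by real_asymp
    show "((\<lambda>u. - ((1 + u) powr (- e)) / e) has_real_derivative (1 + u) powr (- 1 - e)) (at u)"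
      if "0 \<le> u" for u :: real
      using assms that by (auto intro!: derivative_eq_intros simp: powr_diff powr_minus divide_simps)
  qed auto
  also have "(\<integral>\<^sup>+ u. ennreal ((1 + u) powr (- 1 - e)) * indicator {0..} u \<partial>lborel)
      = (\<integral>\<^sup>+ u. ennreal (?f u) \<partial>lborel)"
    by (intro nn_integral_cong) (auto simp: indicator_def)
  finally have "(\<integral>\<^sup>+ u. ennreal (?f u) \<partial>lborel) < \<infinity>" by simp
  then have "integrable lborel ?f"
    by (intro integrableI_nonneg) auto
  \<comment> \<open>The half-line function plus its reflection dominates the even weight; at
    \<open>0\<close> the sum counts it twice, so a bound is used instead of an equality.\<close>
  from this integrable_lborel_affine[OF this, of "-1" 0]
  have "integrable lborel (\<lambda>u. ?f u + ?f (- u))" by simp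
  then show ?thesis
    by (rule Bochner_Integration.integrable_bound) (auto simp: indicator_def)
qed

text \<open>The exponent -N-e is split evenly over the N coordinates. As each coordinate is at most
  the norm and the exponents are negative, a product of one-dimensional weights dominates.\<close>

lemma integrable_bracket:
  fixes e :: real
  assumes "e > 0"
  shows "integrable lborel (\<lambda>x::'a::euclidean_space. (1 + norm x) powr (- real DIM('a) - e))"
proof -
  let ?N = "real DIM('a)"
  let ?e = "e / ?N"
  have "integrable lborel (\<lambda>x::'a. \<Prod>b\<in>Basis. (1 + \<bar>x \<bullet> b\<bar>) powr (- 1 - ?e))"
    using assms by (intro integrable_lborel_prod integrable_bracket_real) auto
  then show ?thesis
  proof (rule Bochner_Integration.integrable_bound)
    have "(1 + norm x) powr (- ?N - e) \<le> (\<Prod>b\<in>Basis. (1 + \<bar>x \<bullet> b\<bar>) powr (- 1 - ?e))" for x :: 'a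
    proof -
      have "(1 + norm x) powr (- ?N - e) = (\<Prod>b\<in>(Basis::'a set). (1 + norm x) powr (- 1 - ?e))"
      proof -
        have "0 < 1 + norm x" by (simp add: add_pos_nonneg)
        then have "0 < (1 + norm x) powr (- 1 - ?e)" by simp
        then have "((1 + norm x) powr (- 1 - ?e)) ^ DIM('a) = (1 + norm x) powr ((- 1 - ?e) * ?N)"
          by (simp add: powr_realpow[symmetric] powr_powr)
        also have "(- 1 - ?e) * ?N = - ?N - e" by (simp add: field_simps)
        finally show ?thesis by simp
      qed
      also have "\<dots> \<le> (\<Prod>b\<in>Basis. (1 + \<bar>x \<bullet> b\<bar>) powr (- 1 - ?e))"
      proof (intro prod_mono conjI powr_mono2' add_mono Basis_le_norm)
        have "0 \<le> ?e" using assms by simp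
        then show "- 1 - ?e \<le> 0" by linarith
      qed (auto simp: add_pos_nonneg)
      finally show ?thesis .
    qed
    then show "AE x in lborel. norm ((1 + norm x) powr (- ?N - e))
        \<le> norm (\<Prod>b\<in>(Basis::'a set). (1 + \<bar>x \<bullet> b\<bar>) powr (- 1 - ?e))"
      by (auto intro!: order.trans[OF _ abs_ge_self])
  qed auto
qed

section \<open>The Fourier transform of a Gaussian\<close>

lemma gauss_fourier_real:
  fixes x s :: real
  assumes "s > 0"
  shows "has_bochner_integral lborel (\<lambda>u. exp (\<i> * complex_of_real (x * u)) * complex_of_real (exp (- s * u\<^sup>2)))
    (complex_of_real (sqrt (pi / s) * exp (- x\<^sup>2 / (4 * s))))"
proof -
  \<comment> \<open>The substitution v = \<open>?r\<close> * u turns the integral into the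
    characteristic function of the standard normal law at \<open>?t\<close>.\<close>
  let ?r = "sqrt (2 * s)" and ?t = "x / sqrt (2 * s)"
  have "has_bochner_integral lborel (\<lambda>v. std_normal_density v *\<^sub>R iexp (?t * v)) (complex_of_real (exp (- ?t\<^sup>2 / 2)))"
  proof -
    interpret real_distribution std_normal_distribution by (rule real_dist_normal_dist)
    have "integrable std_normal_distribution (\<lambda>v. iexp (?t * v))"
      by (intro integrable_iexp) auto
    then have i: "integrable lborel (\<lambda>v. std_normal_density v *\<^sub>R iexp (?t * v))"
      by (subst (asm) integrable_density) auto
    have "(LINT v|lborel. std_normal_density v *\<^sub>R iexp (?t * v)) = char std_normal_distribution ?t"
      unfolding char_def by (subst integral_density) auto
    with i show ?thesis
      by (simp add: has_bochner_integral_iff char_std_normal_distribution)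
  qed
  then have "has_bochner_integral lborel (\<lambda>u. std_normal_density (?r * u) *\<^sub>R iexp (?t * (?r * u)))
     (complex_of_real (exp (- ?t\<^sup>2 / 2)) /\<^sub>R \<bar>?r\<bar>)"
    using assms by (subst (asm) lborel_has_bochner_integral_real_affine_iff[of ?r _ _ 0]) simp_all
  then have "has_bochner_integral lborel (\<lambda>u. sqrt (2 * pi) *\<^sub>R (std_normal_density (?r * u) *\<^sub>R iexp (?t * (?r * u))))
     (sqrt (2 * pi) *\<^sub>R (complex_of_real (exp (- ?t\<^sup>2 / 2)) /\<^sub>R \<bar>?r\<bar>))"
    by (rule has_bochner_integral_scaleR_right[rotated])
  then show ?thesis
    using assms
    by (simp add: std_normal_density_def power_mult_distrib scaleR_conv_of_real real_sqrt_mult real_sqrt_divide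
        power_divide field_simps)
qed

lemma norm_squared_Basis: "(norm (y::'a::euclidean_space))\<^sup>2 = (\<Sum>b\<in>Basis. (y \<bullet> b)\<^sup>2)"
  unfolding dot_square_norm[symmetric] by (subst euclidean_inner) (simp add: power2_eq_square)

lemma gauss_integrable:
  assumes "s > 0"
  shows "integrable lborel (\<lambda>\<xi>::'a::euclidean_space. exp (- s * (norm \<xi>)\<^sup>2))"
proof -
  have "integrable lborel (\<lambda>u::real. norm (exp (\<i> * complex_of_real (0 * u)) * complex_of_real (exp (- s * u\<^sup>2))))"
    using gauss_fourier_real[OF assms, of 0] by (intro integrable_norm) (auto simp: has_bochner_integral_iff)
  then have "integrable lborel (\<lambda>\<xi>::'a. \<Prod>b\<in>Basis. exp (- s * (\<xi> \<bullet> b)\<^sup>2))"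
    by (intro integrable_lborel_prod) (simp add: norm_mult)
  also have "(\<lambda>\<xi>::'a. \<Prod>b\<in>Basis. exp (- s * (\<xi> \<bullet> b)\<^sup>2)) = (\<lambda>\<xi>. exp (- s * (norm \<xi>)\<^sup>2))"
    by (simp add: exp_sum[symmetric] norm_squared_Basis sum_distrib_left sum_negf)
  finally show ?thesis .
qed

text \<open>The complex exponential factors over the coordinates while the cosine does not, so the
  product formula is applied to the complex integrand and the real part is taken last.\<close>

lemma gauss_fourier:
  fixes x :: "'a::euclidean_space"
  assumes "s > 0"
  shows "(LINT \<xi>|lborel. cos (x \<bullet> \<xi>) * exp (- s * (norm \<xi>)\<^sup>2))
    = sqrt (pi / s) ^ DIM('a) * exp (- (norm x)\<^sup>2 / (4 * s))"
proof -
  let ?f = "\<lambda>b u. exp (\<i> * complex_of_real ((x \<bullet> b) * u)) * complex_of_real (exp (- s * u\<^sup>2))"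
  have eq: "(\<Prod>b\<in>Basis. ?f b (\<xi> \<bullet> b))
      = exp (\<i> * complex_of_real (x \<bullet> \<xi>)) * complex_of_real (exp (- s * (norm \<xi>)\<^sup>2))" for \<xi> :: 'a
  proof -
    have "(\<Prod>b\<in>Basis. ?f b (\<xi> \<bullet> b)) = exp (\<Sum>b\<in>Basis. \<i> * complex_of_real ((x \<bullet> b) * (\<xi> \<bullet> b)))
        * complex_of_real (exp (\<Sum>b\<in>Basis. - s * (\<xi> \<bullet> b)\<^sup>2))"
      by (simp only: prod.distrib exp_sum finite_Basis of_real_prod)
    also have "(\<Sum>b\<in>Basis. \<i> * complex_of_real ((x \<bullet> b) * (\<xi> \<bullet> b))) = \<i> * complex_of_real (x \<bullet> \<xi>)"
      by (simp only: sum_distrib_left[symmetric] of_real_sum[symmetric] euclidean_inner[of x \<xi>])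
    also have "(\<Sum>b\<in>Basis. - s * (\<xi> \<bullet> b)\<^sup>2) = - s * (norm \<xi>)\<^sup>2"
      by (simp only: sum_distrib_left[symmetric] norm_squared_Basis)
    finally show ?thesis .
  qed
  have i: "integrable lborel (?f b)" for b
    using gauss_fourier_real[OF assms, of "x \<bullet> b"] by (simp add: has_bochner_integral_iff)
  have "(LINT \<xi>|lborel. cos (x \<bullet> \<xi>) * exp (- s * (norm \<xi>)\<^sup>2)) = (LINT \<xi>|lborel. Re (\<Prod>b\<in>Basis. ?f b (\<xi> \<bullet> b)))"
    unfolding eq by (intro Bochner_Integration.integral_cong refl) (simp add: Re_exp)
  also have "\<dots> = Re (LINT \<xi>|lborel. (\<Prod>b\<in>Basis. ?f b ((\<xi>::'a) \<bullet> b)))"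
    by (intro integral_Re integrable_lborel_prod i)
  also have "(LINT \<xi>|lborel. (\<Prod>b\<in>Basis. ?f b ((\<xi>::'a) \<bullet> b))) = (\<Prod>b\<in>Basis. (LINT u|lborel. ?f b u))"
    by (intro integral_lborel_prod i)
  also have "\<dots> = (\<Prod>b\<in>Basis. complex_of_real (sqrt (pi / s) * exp (- (x \<bullet> b)\<^sup>2 / (4 * s))))"
    by (intro prod.cong refl has_bochner_integral_integral_eq gauss_fourier_real assms)
  also have "Re \<dots> = (\<Prod>b\<in>Basis. sqrt (pi / s) * exp (- (x \<bullet> b)\<^sup>2 / (4 * s)))"
    by (simp only: of_real_prod[symmetric] Re_complex_of_real)
  also have "\<dots> = sqrt (pi / s) ^ DIM('a) * exp (- (norm x)\<^sup>2 / (4 * s))"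
    by (simp add: prod.distrib exp_sum[symmetric] norm_squared_Basis sum_negf sum_divide_distrib)
  finally show ?thesis .
qed

section \<open>Positive mixtures of exponentials\<close>

text \<open>This is (2 pi)^N times the classical heat kernel at time s; the normalisation is
  postponed to \<open>P_frac\<close>.\<close>

definition gauss_ft :: "real \<Rightarrow> 'a::euclidean_space \<Rightarrow> real" where
  "gauss_ft s x = sqrt (pi / s) ^ DIM('a) * exp (- (norm x)\<^sup>2 / (4 * s))"

text \<open>The profile is a function of the squared norm, so that Gaussians correspond to
  exponentials in l. For such even integrands the cosine carries the whole Fourier
  transform.\<close>

definition radial_ft :: "(real \<Rightarrow> real) \<Rightarrow> 'a::euclidean_space \<Rightarrow> real" where
  "radial_ft g x = (LINT \<xi>|lborel. cos (x \<bullet> \<xi>) * g ((norm \<xi>)\<^sup>2))"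

lemma radial_ft_exp: "s > 0 \<Longrightarrow> radial_ft (\<lambda>l. exp (- s * l)) x = gauss_ft s x"
  unfolding radial_ft_def gauss_ft_def by (rule gauss_fourier)

text \<open>These are the Laplace transforms of finite measures on \<open>[0, \<infinity>)\<close>, except that the value at \<open>0\<close>
  may exceed the total mass: in the limit rule \<open>g 0\<close> is only bounded from below. The values at negative
  arguments are irrelevant.\<close>

inductive_set laplace_cone :: "(real \<Rightarrow> real) set" where
  exp: "0 \<le> s \<Longrightarrow> (\<lambda>l. exp (- s * l)) \<in> laplace_cone"
| add: "g \<in> laplace_cone \<Longrightarrow> h \<in> laplace_cone \<Longrightarrow> (\<lambda>l. g l + h l) \<in> laplace_cone"
| scale: "0 \<le> c \<Longrightarrow> g \<in> laplace_cone \<Longrightarrow> (\<lambda>l. c * g l) \<in> laplace_cone"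
| lim: "(\<And>M::nat. h M \<in> laplace_cone) \<Longrightarrow> (\<And>l. 0 < l \<Longrightarrow> (\<lambda>M. h M l) \<longlonglongrightarrow> g l) \<Longrightarrow>
        (\<And>M. h M 0 \<le> g 0) \<Longrightarrow> g \<in> laplace_cone"

text \<open>The bound by the value at \<open>0\<close> later supplies dominating functions. It
  survives limits because the limit rule demands \<open>h M 0 \<le> g 0\<close>.\<close>

lemma laplace_cone_bounds: "g \<in> laplace_cone \<Longrightarrow> 0 \<le> l \<Longrightarrow> 0 \<le> g l \<and> g l \<le> g 0"
proof (induction arbitrary: l rule: laplace_cone.induct)
  case (exp s)
  then show ?case by simp
next
  case (add g h)
  then show ?case by (meson add_mono add_nonneg_nonneg)
next
  case (scale c g)
  then show ?case by (meson mult_left_mono mult_nonneg_nonneg)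
next
  case (lim h g)
  have b: "0 \<le> h M l" "h M l \<le> g 0" for M
    using lim.IH[OF lim.prems, of M] lim.hyps(3)[of M] by linarith+
  show ?case
  proof (cases "l = 0")
    case True
    then show ?thesis using b[of 0] lim.IH[of 0 0] lim.hyps(3)[of 0] by simp
  next
    case False
    with lim.prems have "(\<lambda>M. h M l) \<longlonglongrightarrow> g l" by (intro lim.hyps) auto
    with b show ?thesis
      by (auto intro: LIMSEQ_le_const LIMSEQ_le_const2)
  qed
qed

lemma laplace_cone_radial_measurable:
  "g \<in> laplace_cone \<Longrightarrow> (\<lambda>\<xi>::'a::euclidean_space. g ((norm \<xi>)\<^sup>2)) \<in> borel_measurable borel"
proof (induction rule: laplace_cone.induct)
  case (lim h g)
  show ?case
  proof (rule borel_measurable_LIMSEQ_real)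
    \<comment> \<open>The limit rule gives no convergence at \<open>0\<close>, so the approximants
      are replaced there by the value of the limit.\<close>
    show "(\<lambda>\<xi>::'a. if \<xi> = 0 then g 0 else h M ((norm \<xi>)\<^sup>2)) \<in> borel_measurable borel" for M
      using lim.IH[of M] by measurable
    show "(\<lambda>M. if \<xi> = 0 then g 0 else h M ((norm \<xi>)\<^sup>2)) \<longlonglongrightarrow> g ((norm \<xi>)\<^sup>2)" for \<xi> :: 'a
      using lim.hyps(2)[of "(norm \<xi>)\<^sup>2"] by (cases "\<xi> = 0") auto
  qed
qed auto

lemma laplace_cone_mult_exp:
  assumes "0 \<le> s"
  shows "g \<in> laplace_cone \<Longrightarrow> (\<lambda>l. exp (- s * l) * g l) \<in> laplace_cone"
proof (induction rule: laplace_cone.induct)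
  case (exp t)
  have "(\<lambda>l. exp (- (s + t) * l)) \<in> laplace_cone"
    using assms exp by (intro laplace_cone.exp) auto
  then show ?case by (simp add: exp_add[symmetric] algebra_simps)
next
  case (add g h)
  then show ?case using laplace_cone.add[OF add.IH] by (simp add: algebra_simps)
next
  case (scale c g)
  then show ?case using laplace_cone.scale[OF scale.hyps(1) scale.IH] by (simp add: algebra_simps)
next
  case (lim h g)
  show ?case
    by (rule laplace_cone.lim[OF lim.IH]) (use lim.hyps in \<open>auto intro: tendsto_mult_left\<close>)
qed

text \<open>Closure under products takes two inductions, one per factor. The generator case of this
  one is \<open>laplace_cone_mult_exp\<close>, whose own generator case is that a product of
  exponentials is an exponential.\<close>

lemma laplace_cone_mult:
  assumes f: "f \<in> laplace_cone"
  shows "g \<in> laplace_cone \<Longrightarrow> (\<lambda>l. g l * f l) \<in> laplace_cone"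
proof (induction rule: laplace_cone.induct)
  case (exp s)
  then show ?case by (intro laplace_cone_mult_exp f)
next
  case (add g h)
  then show ?case using laplace_cone.add[OF add.IH] by (simp add: algebra_simps)
next
  case (scale c g)
  then show ?case using laplace_cone.scale[OF scale.hyps(1) scale.IH] by (simp add: algebra_simps)
next
  case (lim h g)
  show ?case
  proof (rule laplace_cone.lim[OF lim.IH])
    show "(\<lambda>M. h M l * f l) \<longlonglongrightarrow> g l * f l" if "0 < l" for l
      using that by (intro tendsto_mult lim.hyps(2) tendsto_const)
    show "h M 0 * f 0 \<le> g 0 * f 0" for M
      using laplace_cone_bounds[OF f, of 0] lim.hyps(3) by (intro mult_right_mono) auto
  qed
qed

lemma laplace_cone_const: "0 \<le> c \<Longrightarrow> (\<lambda>_. c) \<in> laplace_cone"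
  using laplace_cone.scale[OF _ laplace_cone.exp[of 0], of c] by simp

lemma laplace_cone_power: "g \<in> laplace_cone \<Longrightarrow> (\<lambda>l. g l ^ k) \<in> laplace_cone"
  by (induction k) (auto intro: laplace_cone_const laplace_cone_mult)

lemma laplace_cone_sum:
  fixes M :: nat
  shows "(\<And>k. k < M \<Longrightarrow> g k \<in> laplace_cone) \<Longrightarrow> (\<lambda>l. \<Sum>k<M. g k l) \<in> laplace_cone"
  by (induction M) (auto intro: laplace_cone_const laplace_cone.add)

lemma sum_le_sums:
  fixes f :: "nat \<Rightarrow> real"
  assumes "f sums s" "\<And>k. 0 \<le> f k"
  shows "(\<Sum>k<M. f k) \<le> s"
  using sum_le_suminf[of f "{..<M}"] assms by (auto simp: sums_iff)

text \<open>The Taylor polynomials of exp have nonnegative coefficients, and since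
  \<open>g 0\<close> is nonnegative they stay below the exponential at \<open>0\<close>, as the
  limit rule requires.\<close>

lemma laplace_cone_exp_comp:
  assumes "g \<in> laplace_cone"
  shows "(\<lambda>l. exp (g l)) \<in> laplace_cone"
proof (rule laplace_cone.lim)
  show "(\<lambda>l. \<Sum>k<M. 1 / fact k * g l ^ k) \<in> laplace_cone" for M
    by (intro laplace_cone_sum laplace_cone.scale laplace_cone_power assms) auto
  have s: "(\<lambda>k. 1 / fact k * x ^ k) sums exp x" for x :: real
    using exp_converges[of x] by (simp add: field_simps)
  show "(\<lambda>M. \<Sum>k<M. 1 / fact k * g l ^ k) \<longlonglongrightarrow> exp (g l)" for l
    using s by (simp add: sums_def)
  show "(\<Sum>k<M. 1 / fact k * g 0 ^ k) \<le> exp (g 0)" for M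
    using laplace_cone_bounds[OF assms, of 0] by (intro sum_le_sums[OF s]) auto
qed

section \<open>Binomial series and the stable approximants\<close>

lemma gbinomial_alternating_nonneg:
  fixes \<alpha> :: real
  assumes "0 < \<alpha>" "\<alpha> < 1"
  shows "0 \<le> - ((\<alpha> gchoose Suc k) * (- 1) ^ Suc k)"
proof -
  \<comment> \<open>Up to the factor \<alpha> / (k+1)!, the coefficient is the product
    (1-\<alpha>)(2-\<alpha>)...(k-\<alpha>), all of whose factors are positive.\<close>
  have "0 \<le> pochhammer (1 - \<alpha>) k"
    using assms by (intro less_imp_le pochhammer_pos) auto
  then have "0 \<le> \<alpha> * pochhammer (1 - \<alpha>) k / fact (Suc k)"
    using assms by (intro divide_nonneg_nonneg mult_nonneg_nonneg) auto
  also have "\<alpha> * pochhammer (1 - \<alpha>) k = - pochhammer (- \<alpha>) (Suc k)"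
    by (simp add: pochhammer_rec)
  also have "- pochhammer (- \<alpha>) (Suc k) / fact (Suc k) = - ((\<alpha> gchoose Suc k) * (- 1) ^ Suc k)"
    unfolding gbinomial_pochhammer by (cases "even (Suc k)") (simp_all del: power_Suc even_Suc)
  finally show ?thesis .
qed

lemma gbinomial_alternating_sums:
  fixes \<alpha> x :: real
  assumes "0 < x" "x < 1"
  shows "(\<lambda>k. - ((\<alpha> gchoose Suc k) * (- 1) ^ Suc k) * x ^ Suc k) sums (1 - (1 - x) powr \<alpha>)"
proof -
  have "(\<lambda>k. (\<alpha> gchoose k) * (- x) ^ k) sums (1 + - x) powr \<alpha>"
    using assms by (intro gen_binomial_real) auto
  then have "(\<lambda>k. (\<alpha> gchoose Suc k) * (- x) ^ Suc k) sums ((1 - x) powr \<alpha> - 1)"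
    by (subst sums_Suc_iff) auto
  from sums_minus[OF this] show ?thesis
    unfolding power_minus[of x] by (simp only: mult.assoc minus_mult_left minus_diff_eq)
qed

text \<open>For x < 1 the weighted partial sums are at most 1 - (1-x)^\<alpha>, hence at most 1; a
  finite sum is continuous, so x may tend to 1.\<close>

lemma gbinomial_alternating_sum_le_1:
  fixes \<alpha> :: real
  assumes "0 < \<alpha>" "\<alpha> < 1"
  shows "(\<Sum>k<M. - ((\<alpha> gchoose Suc k) * (- 1) ^ Suc k)) \<le> 1"
proof -
  let ?A = "\<lambda>k. - ((\<alpha> gchoose Suc k) * (- 1) ^ Suc k)"
  have "((\<lambda>x. \<Sum>k<M. ?A k * x ^ Suc k) \<longlongrightarrow> (\<Sum>k<M. ?A k * 1 ^ Suc k)) (at_left 1)"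
    by (intro tendsto_intros)
  moreover have "\<forall>\<^sub>F x in at_left 1. (\<Sum>k<M. ?A k * x ^ Suc k) \<le> 1"
    unfolding eventually_at_left_field
  proof (intro exI[of _ 0] conjI allI impI)
    fix x :: real assume "0 < x" "x < 1"
    then have "(\<Sum>k<M. ?A k * x ^ Suc k) \<le> 1 - (1 - x) powr \<alpha>"
      by (intro sum_le_sums[OF gbinomial_alternating_sums] mult_nonneg_nonneg
          gbinomial_alternating_nonneg[OF assms] zero_le_power) simp_all
    then show "(\<Sum>k<M. ?A k * x ^ Suc k) \<le> 1" using powr_ge_zero[of "1 - x" \<alpha>] by linarith
  qed auto
  ultimately have "(\<Sum>k<M. ?A k * 1 ^ Suc k) \<le> 1"
    by (rule tendsto_upperbound) auto
  then show ?thesis by simp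
qed

text \<open>With \<open>X = exp (- l / n)\<close> this is \<open>exp (- n\<^sup>\<alpha> (1 - X)\<^sup>\<alpha>)\<close>, the generating function of a discrete stable
  law: by the binomial series it is a power series in \<open>X\<close> with nonnegative coefficients.\<close>

definition stable_approx :: "real \<Rightarrow> real \<Rightarrow> real \<Rightarrow> real" where
  "stable_approx \<alpha> n l = exp (- (n powr \<alpha> * (1 - exp (- l / n)) powr \<alpha>))"

lemma stable_approx_laplace_cone:
  assumes "0 < \<alpha>" "\<alpha> < 1" "0 < n"
  shows "stable_approx \<alpha> n \<in> laplace_cone"
proof -
  let ?A = "\<lambda>k. - ((\<alpha> gchoose Suc k) * (- 1) ^ Suc k)"
  let ?q = "\<lambda>l. 1 - (1 - exp (- l / n)) powr \<alpha>"
  have "?q \<in> laplace_cone"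
  proof (rule laplace_cone.lim)
    show "(\<lambda>l. \<Sum>k<M. ?A k * exp (- (real (Suc k) / n) * l)) \<in> laplace_cone" for M
      using assms gbinomial_alternating_nonneg[OF assms(1,2)]
      by (intro laplace_cone_sum laplace_cone.scale laplace_cone.exp) auto
    show "(\<lambda>M. \<Sum>k<M. ?A k * exp (- (real (Suc k) / n) * l)) \<longlonglongrightarrow> ?q l" if "0 < l" for l
    proof -
      have "(\<lambda>M. \<Sum>k<M. ?A k * exp (- l / n) ^ Suc k) \<longlonglongrightarrow> ?q l"
        using gbinomial_alternating_sums[of "exp (- l / n)" \<alpha>] that assms unfolding sums_def by simp
      moreover have "exp (- l / n) ^ Suc k = exp (- (real (Suc k) / n) * l)" for k
        unfolding exp_of_nat_mult[symmetric] by (rule arg_cong[of _ _ exp]) simp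
      ultimately show ?thesis by (simp only:)
    qed
    \<comment> \<open>The point l = 0 corresponds to the endpoint X = 1 of the binomial series,
      where an upper bound on the partial sums is enough for the limit rule.\<close>
    show "(\<Sum>k<M. ?A k * exp (- (real (Suc k) / n) * 0)) \<le> ?q 0" for M
      using gbinomial_alternating_sum_le_1[OF assms(1,2), of M] by simp
  qed
  \<comment> \<open>Writing (1-X)^\<alpha> as 1 - \<open>?q\<close> splits off the constant
    exp(-n^\<alpha>) and leaves the exponential of a cone member.\<close>
  then have "(\<lambda>l. exp (- (n powr \<alpha>)) * exp (n powr \<alpha> * ?q l)) \<in> laplace_cone"
    by (intro laplace_cone.scale laplace_cone_exp_comp) auto
  then show ?thesis
    by (simp add: stable_approx_def[abs_def] exp_add[symmetric] algebra_simps)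
qed

section \<open>Transfer of linear inequalities to mixtures\<close>

lemma tendsto_radial_ft:
  fixes x :: "'a::euclidean_space"
  assumes w: "integrable lborel w"
    and h: "\<And>M::nat. (\<lambda>\<xi>::'a. h M ((norm \<xi>)\<^sup>2)) \<in> borel_measurable borel"
    and g: "(\<lambda>\<xi>::'a. g ((norm \<xi>)\<^sup>2)) \<in> borel_measurable borel"
    and lim: "\<And>l. 0 < l \<Longrightarrow> (\<lambda>M. h M l) \<longlonglongrightarrow> g l"
    and bound: "\<And>M (\<xi>::'a). \<bar>h M ((norm \<xi>)\<^sup>2)\<bar> \<le> w \<xi>"
  shows "(\<lambda>M. radial_ft (h M) x) \<longlonglongrightarrow> radial_ft g x"
  unfolding radial_ft_def
proof (rule integral_dominated_convergence[OF _ _ w])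
  \<comment> \<open>Convergence is known only for l > 0, so the null set consisting of the origin is
    discarded.\<close>
  show "AE \<xi> in lborel. (\<lambda>M. cos (x \<bullet> \<xi>) * h M ((norm \<xi>)\<^sup>2)) \<longlonglongrightarrow> cos (x \<bullet> \<xi>) * g ((norm \<xi>)\<^sup>2)"
    using AE_lborel_singleton[of 0] by eventually_elim (auto intro!: tendsto_intros lim)
  show "AE \<xi> in lborel. norm (cos (x \<bullet> \<xi>) * h M ((norm \<xi>)\<^sup>2)) \<le> w \<xi>" for M
  proof (rule AE_I2)
    fix \<xi>
    have "norm (cos (x \<bullet> \<xi>) * h M ((norm \<xi>)\<^sup>2)) \<le> 1 * \<bar>h M ((norm \<xi>)\<^sup>2)\<bar>"
      unfolding real_norm_def abs_mult by (intro mult_right_mono) auto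
    with bound[of M \<xi>] show "norm (cos (x \<bullet> \<xi>) * h M ((norm \<xi>)\<^sup>2)) \<le> w \<xi>" by linarith
  qed
qed (use h g in measurable)

text \<open>Cone members need not decay, constants being among them; the Gaussian factor makes the
  Fourier integral converge.\<close>

lemma laplace_cone_integrable:
  fixes x :: "'a::euclidean_space"
  assumes "g \<in> laplace_cone" "b > 0"
  shows "integrable lborel (\<lambda>\<xi>. cos (x \<bullet> \<xi>) * (exp (- b * (norm \<xi>)\<^sup>2) * g ((norm \<xi>)\<^sup>2)))"
proof (rule Bochner_Integration.integrable_bound)
  show "integrable lborel (\<lambda>\<xi>::'a. g 0 * exp (- b * (norm \<xi>)\<^sup>2))"
    by (intro integrable_mult_right gauss_integrable assms)
  show "(\<lambda>\<xi>. cos (x \<bullet> \<xi>) * (exp (- b * (norm \<xi>)\<^sup>2) * g ((norm \<xi>)\<^sup>2))) \<in> borel_measurable lborel"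
    using laplace_cone_radial_measurable[OF assms(1), where ?'a='a] by measurable
  show "AE \<xi> in lborel. norm (cos (x \<bullet> \<xi>) * (exp (- b * (norm \<xi>)\<^sup>2) * g ((norm \<xi>)\<^sup>2)))
      \<le> norm (g 0 * exp (- b * (norm \<xi>)\<^sup>2))"
  proof (rule AE_I2)
    fix \<xi> :: 'a
    have "norm (cos (x \<bullet> \<xi>) * (exp (- b * (norm \<xi>)\<^sup>2) * g ((norm \<xi>)\<^sup>2)))
        \<le> 1 * (exp (- b * (norm \<xi>)\<^sup>2) * \<bar>g ((norm \<xi>)\<^sup>2)\<bar>)"
      by (simp add: abs_mult mult_left_le_one_le)
    also have "\<dots> \<le> norm (g 0 * exp (- b * (norm \<xi>)\<^sup>2))"
      using laplace_cone_bounds[OF assms(1), of "(norm \<xi>)\<^sup>2"] by (simp add: abs_mult mult.commute)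
    finally show "norm (cos (x \<bullet> \<xi>) * (exp (- b * (norm \<xi>)\<^sup>2) * g ((norm \<xi>)\<^sup>2)))
      \<le> norm (g 0 * exp (- b * (norm \<xi>)\<^sup>2))" .
  qed
qed

text \<open>A linear inequality between the Fourier transforms of radial functions and their profiles.
  Once it holds for all Gaussians, it holds for every positive mixture of them.\<close>

definition test_form ::
    "real \<Rightarrow> 'a::euclidean_space \<Rightarrow> real \<Rightarrow> 'a \<Rightarrow> (real \<Rightarrow> real) \<Rightarrow> real set \<Rightarrow> (real \<Rightarrow> real) \<Rightarrow> real" where
  "test_form a x b y c \<Lambda> g = a * radial_ft g x + b * radial_ft g y + (\<Sum>l\<in>\<Lambda>. c l * g l)"

text \<open>The damping factor keeps all integrals finite and turns the generator with parameter s
  into the assumption at \<beta> + s > 0. The constant \<open>c0\<close> acts as a coefficient at l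
  = 0, hence the term \<open>c0 * g 0\<close>; its sign matters in the limit case, where
  \<open>h M 0\<close> is only bounded by \<open>g 0\<close>.\<close>

lemma laplace_cone_test_form:
  fixes x y :: "'a::euclidean_space"
  assumes \<Lambda>: "\<Lambda> \<subseteq> {0<..}" and "0 \<le> c0" and \<beta>: "0 < \<beta>"
    and pos: "\<And>s. 0 < s \<Longrightarrow> 0 \<le> test_form a x b y c \<Lambda> (\<lambda>l. exp (- s * l)) + c0"
  shows "g \<in> laplace_cone \<Longrightarrow> 0 \<le> test_form a x b y c \<Lambda> (\<lambda>l. exp (- \<beta> * l) * g l) + c0 * g 0"
proof (induction rule: laplace_cone.induct)
  case (exp s)
  have "(\<lambda>l. exp (- \<beta> * l) * exp (- s * l)) = (\<lambda>l. exp (- (\<beta> + s) * l))"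
    by (simp add: exp_add[symmetric] algebra_simps)
  with pos[of "\<beta> + s"] \<beta> exp show ?case by simp
next
  case (add g h)
  have "radial_ft (\<lambda>l. exp (- \<beta> * l) * (g l + h l)) z
      = radial_ft (\<lambda>l. exp (- \<beta> * l) * g l) z + radial_ft (\<lambda>l. exp (- \<beta> * l) * h l) z" for z :: 'a
    unfolding radial_ft_def
    by (subst Bochner_Integration.integral_add[symmetric])
      (use laplace_cone_integrable add.hyps \<beta> in \<open>auto simp: algebra_simps\<close>)
  then have "test_form a x b y c \<Lambda> (\<lambda>l. exp (- \<beta> * l) * (g l + h l))
      = test_form a x b y c \<Lambda> (\<lambda>l. exp (- \<beta> * l) * g l) + test_form a x b y c \<Lambda> (\<lambda>l. exp (- \<beta> * l) * h l)"
    by (simp add: test_form_def algebra_simps sum.distrib)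
  with add.IH show ?case by (simp add: algebra_simps)
next
  case (scale k g)
  have "radial_ft (\<lambda>l. exp (- \<beta> * l) * (k * g l)) z = k * radial_ft (\<lambda>l. exp (- \<beta> * l) * g l) z" for z :: 'a
    unfolding radial_ft_def by (subst integral_mult_right_zero[symmetric]) (simp add: mult_ac)
  then have "test_form a x b y c \<Lambda> (\<lambda>l. exp (- \<beta> * l) * (k * g l))
      = k * test_form a x b y c \<Lambda> (\<lambda>l. exp (- \<beta> * l) * g l)"
    by (simp add: test_form_def algebra_simps sum_distrib_left)
  moreover have "0 \<le> k * (test_form a x b y c \<Lambda> (\<lambda>l. exp (- \<beta> * l) * g l) + c0 * g 0)"
    using scale by (intro mult_nonneg_nonneg)
  ultimately show ?case by (simp add: algebra_simps)
next
  case (lim h g)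
  note g = laplace_cone.lim[OF lim.hyps]
  have "(\<lambda>M. radial_ft (\<lambda>l. exp (- \<beta> * l) * h M l) z) \<longlonglongrightarrow> radial_ft (\<lambda>l. exp (- \<beta> * l) * g l) z" for z :: 'a
  proof (rule tendsto_radial_ft)
    show "integrable lborel (\<lambda>\<xi>::'a. exp (- \<beta> * (norm \<xi>)\<^sup>2) * g 0)"
      by (intro integrable_mult_left gauss_integrable \<beta>)
    show "(\<lambda>\<xi>::'a. exp (- \<beta> * (norm \<xi>)\<^sup>2) * h M ((norm \<xi>)\<^sup>2)) \<in> borel_measurable borel" for M
      using laplace_cone_radial_measurable[OF lim.hyps(1), where ?'a='a] by measurable
    show "(\<lambda>\<xi>::'a. exp (- \<beta> * (norm \<xi>)\<^sup>2) * g ((norm \<xi>)\<^sup>2)) \<in> borel_measurable borel"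
      using laplace_cone_radial_measurable[OF g, where ?'a='a] by measurable
    show "\<bar>exp (- \<beta> * (norm \<xi>)\<^sup>2) * h M ((norm \<xi>)\<^sup>2)\<bar> \<le> exp (- \<beta> * (norm \<xi>)\<^sup>2) * g 0" for M and \<xi> :: 'a
      using laplace_cone_bounds[OF lim.hyps(1), of "(norm \<xi>)\<^sup>2" M] lim.hyps(3)[of M]
      by (simp add: abs_mult)
  qed (intro tendsto_intros lim.hyps)
  then have "(\<lambda>M. test_form a x b y c \<Lambda> (\<lambda>l. exp (- \<beta> * l) * h M l) + c0 * g 0)
      \<longlonglongrightarrow> test_form a x b y c \<Lambda> (\<lambda>l. exp (- \<beta> * l) * g l) + c0 * g 0"
    unfolding test_form_def using \<Lambda> by (intro tendsto_intros lim.hyps) auto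
  moreover have "0 \<le> test_form a x b y c \<Lambda> (\<lambda>l. exp (- \<beta> * l) * h M l) + c0 * g 0" for M
    using lim.IH[of M] mult_left_mono[OF lim.hyps(3)[of M] \<open>0 \<le> c0\<close>] by linarith
  ultimately show ?case by (auto intro: LIMSEQ_le_const)
qed

section \<open>Convergence of the approximants to the stable profile\<close>

lemma integrable_exp_norm_powr:
  fixes c \<kappa> :: real
  assumes "c > 0" "\<kappa> > 0"
  shows "integrable lborel (\<lambda>\<xi>::'a::euclidean_space. exp (- c * norm \<xi> powr \<kappa>))"
proof -
  let ?p = "real DIM('a) + 1"
  have "((\<lambda>r::real. exp (- c * r powr \<kappa>) * (1 + r) powr ?p) \<longlongrightarrow> 0) at_top"
    using assms by real_asymp
  then have "\<forall>\<^sub>F r::real in at_top. exp (- c * r powr \<kappa>) * (1 + r) powr ?p < 1"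
    by (rule order_tendstoD) simp
  then obtain R where R: "\<And>r::real. r \<ge> R \<Longrightarrow> exp (- c * r powr \<kappa>) * (1 + r) powr ?p < 1"
    by (auto simp: eventually_at_top_linorder)
  \<comment> \<open>Beyond \<open>R\<close> the product is below 1; before \<open>R\<close> the
    exponential is at most 1 and the power is largest at the right end.\<close>
  define C where "C = max 1 ((1 + \<bar>R\<bar>) powr ?p)"
  have bound: "exp (- c * r powr \<kappa>) * (1 + r) powr ?p \<le> C" if "0 \<le> r" for r
  proof (cases "r \<ge> R")
    case True
    then show ?thesis using R[of r] by (simp add: C_def)
  next
    case False
    have "exp (- c * r powr \<kappa>) * (1 + r) powr ?p \<le> 1 * (1 + \<bar>R\<bar>) powr ?p"
      using assms that False by (intro mult_mono powr_mono2) auto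
    then show ?thesis by (simp add: C_def)
  qed
  have "integrable lborel (\<lambda>\<xi>::'a. C * (1 + norm \<xi>) powr (- real DIM('a) - 1))"
    by (intro integrable_mult_right integrable_bracket) simp
  then show ?thesis
  proof (rule Bochner_Integration.integrable_bound)
    have "exp (- c * norm \<xi> powr \<kappa>) \<le> C * (1 + norm \<xi>) powr (- real DIM('a) - 1)" for \<xi> :: 'a
    proof -
      have "0 < 1 + norm \<xi>" by (simp add: add_pos_nonneg)
      moreover have "- real DIM('a) - 1 = - ?p" by simp
      ultimately show ?thesis
        using bound[of "norm \<xi>"] by (simp only: powr_minus) (simp add: field_simps)
    qed
    then show "AE \<xi>::'a in lborel. norm (exp (- c * norm \<xi> powr \<kappa>)) \<le> norm (C * (1 + norm \<xi>) powr (- real DIM('a) - 1))"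
      by (auto intro!: order.trans[OF _ abs_ge_self])
  qed auto
qed

lemma half_le_one_minus_exp:
  fixes u :: real
  assumes "0 \<le> u" "u \<le> 1"
  shows "u / 2 \<le> 1 - exp (- u)"
proof -
  have "exp (- u) \<le> 1 / (1 + u)"
    using exp_ge_add_one_self[of u] assms by (simp add: exp_minus field_simps)
  also have "\<dots> \<le> 1 - u / 2"
  proof -
    \<comment> \<open>The product equals 1 + u (1-u) / 2.\<close>
    have "1 \<le> (1 - u / 2) * (1 + u)"
      using mult_left_mono[OF assms(2,1)] by (simp add: algebra_simps)
    then show ?thesis using assms by (subst pos_divide_le_eq) auto
  qed
  finally show ?thesis by simp
qed

lemma half_le_one_minus_exp':
  fixes u :: real
  assumes "1 \<le> u"
  shows "1 / 2 \<le> 1 - exp (- u)"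
proof -
  have "exp (- u) \<le> exp (- 1)" using assms by simp
  with half_le_one_minus_exp[of 1] show ?thesis by linarith
qed

text \<open>The extra factor \<open>exp (- n\<^bsup>\<alpha>-1\<^esup> l)\<close> tends to \<open>1\<close> but supplies, for \<open>l > n\<close>, the decay that
  \<open>stable_approx\<close> lacks.\<close>

lemma stable_approx_bound:
  assumes \<alpha>: "0 < \<alpha>" "\<alpha> < 1" and "0 < n" and "0 \<le> l"
  shows "exp (- (n powr (\<alpha> - 1)) * l) * stable_approx \<alpha> n l \<le> exp (- ((l / 2) powr \<alpha>))"
proof -
  \<comment> \<open>For l at most n the second term suffices, as 1 - exp(-l/n) is at least l/(2n).
    For l > n the first suffices, because the power with exponent \<alpha> - 1 is
    decreasing.\<close>
  have "(l / 2) powr \<alpha> \<le> n powr (\<alpha> - 1) * l + n powr \<alpha> * (1 - exp (- l / n)) powr \<alpha>"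
  proof (cases "l \<le> n")
    case True
    let ?u = "l / n"
    have u: "0 \<le> ?u" "?u \<le> 1" using assms True by auto
    have "?u / 2 \<le> 1 - exp (- ?u)"
      using half_le_one_minus_exp[OF u] .
    then have "(?u / 2) powr \<alpha> \<le> (1 - exp (- l / n)) powr \<alpha>"
      using \<alpha> u by (intro powr_mono2) auto
    then have "n powr \<alpha> * (?u / 2) powr \<alpha> \<le> n powr \<alpha> * (1 - exp (- l / n)) powr \<alpha>"
      by (intro mult_left_mono) auto
    also have "n powr \<alpha> * (?u / 2) powr \<alpha> = (l / 2) powr \<alpha>"
      using assms by (simp add: powr_mult[symmetric])
    finally show ?thesis using assms by (simp add: add_increasing)
  next
    case False
    then have l: "l > n" "l > 0" using assms by auto
    have "(l / 2) powr \<alpha> \<le> l powr \<alpha>"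
      using l \<alpha> by (intro powr_mono2) auto
    also have "\<dots> = l powr (\<alpha> - 1) * l"
      using l by (simp add: powr_diff)
    also have "\<dots> \<le> n powr (\<alpha> - 1) * l"
      using assms l by (intro mult_right_mono powr_mono2') auto
    also have "\<dots> \<le> n powr (\<alpha> - 1) * l + n powr \<alpha> * (1 - exp (- l / n)) powr \<alpha>"
      by simp
    finally show ?thesis .
  qed
  then show ?thesis by (simp add: stable_approx_def exp_add[symmetric])
qed

text \<open>Both limits are elementary: n (1 - exp(-l/n)) tends to l, and n^(\<alpha>-1) tends to 0
  because \<alpha> < 1. The index \<open>Suc M\<close> keeps n positive.\<close>

lemma stable_approx_tendsto:
  assumes \<alpha>: "0 < \<alpha>" "\<alpha> < 1" and "0 < l"
  shows "(\<lambda>M. exp (- (real (Suc M) powr (\<alpha> - 1)) * l) * stable_approx \<alpha> (real (Suc M)) l)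
    \<longlonglongrightarrow> exp (- (l powr \<alpha>))"
proof -
  have "(\<lambda>M. real (Suc M) * (1 - exp (- l / real (Suc M)))) \<longlonglongrightarrow> l"
    by real_asymp
  then have "(\<lambda>M. (real (Suc M) * (1 - exp (- l / real (Suc M)))) powr \<alpha>) \<longlonglongrightarrow> l powr \<alpha>"
    using assms by (intro tendsto_powr tendsto_const) auto
  moreover have "(real (Suc M) * (1 - exp (- l / real (Suc M)))) powr \<alpha>
      = real (Suc M) powr \<alpha> * (1 - exp (- l / real (Suc M))) powr \<alpha>" for M
    using assms by (intro powr_mult) 
  ultimately have "(\<lambda>M. stable_approx \<alpha> (real (Suc M)) l) \<longlonglongrightarrow> exp (- (l powr \<alpha>))"
    unfolding stable_approx_def by (intro tendsto_exp tendsto_minus) (simp only:)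
  moreover have "(\<lambda>M. real (Suc M) powr (\<alpha> - 1)) \<longlonglongrightarrow> 0"
    using assms by real_asymp
  then have "(\<lambda>M. exp (- (real (Suc M) powr (\<alpha> - 1)) * l)) \<longlonglongrightarrow> exp (- 0 * l)"
    by (intro tendsto_intros)
  ultimately show ?thesis
    using tendsto_mult by fastforce
qed

lemma stable_test_form:
  fixes x y :: "'a::euclidean_space"
  assumes \<alpha>: "0 < \<alpha>" "\<alpha> < 1" and \<Lambda>: "\<Lambda> \<subseteq> {0<..}" and "0 \<le> c0"
    and pos: "\<And>s. 0 < s \<Longrightarrow> 0 \<le> test_form a x b y c \<Lambda> (\<lambda>l. exp (- s * l)) + c0"
  shows "0 \<le> test_form a x b y c \<Lambda> (\<lambda>l. exp (- (l powr \<alpha>))) + c0"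
proof -
  let ?h = "\<lambda>M l. exp (- (real (Suc M) powr (\<alpha> - 1)) * l) * stable_approx \<alpha> (real (Suc M)) l"
  have cone: "stable_approx \<alpha> (real (Suc M)) \<in> laplace_cone" for M
    using \<alpha> by (intro stable_approx_laplace_cone) auto
  have "(\<lambda>M. radial_ft (?h M) z) \<longlonglongrightarrow> radial_ft (\<lambda>l. exp (- (l powr \<alpha>))) z" for z :: 'a
  proof (rule tendsto_radial_ft)
    \<comment> \<open>The bound of \<open>stable_approx_bound\<close> does not depend on n and is
      itself a stretched exponential, so it serves as the dominating function.\<close>
    have "(\<lambda>\<xi>::'a. exp (- (((norm \<xi>)\<^sup>2 / 2) powr \<alpha>))) = (\<lambda>\<xi>. exp (- ((1 / 2) powr \<alpha>) * norm \<xi> powr (2 * \<alpha>)))"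
      by (auto simp: powr_divide powr_powr[symmetric] powr_numeral fun_eq_iff)
    then show "integrable lborel (\<lambda>\<xi>::'a. exp (- (((norm \<xi>)\<^sup>2 / 2) powr \<alpha>)))"
      using integrable_exp_norm_powr[of "(1 / 2) powr \<alpha>" "2 * \<alpha>"] \<alpha> by simp
    show "(\<lambda>\<xi>::'a. ?h M ((norm \<xi>)\<^sup>2)) \<in> borel_measurable borel" for M
      unfolding stable_approx_def by measurable
    show "\<bar>?h M ((norm \<xi>)\<^sup>2)\<bar> \<le> exp (- (((norm \<xi>)\<^sup>2 / 2) powr \<alpha>))" for M and \<xi> :: 'a
      using stable_approx_bound[OF \<alpha>, of "real (Suc M)" "(norm \<xi>)\<^sup>2"]
      by (simp add: abs_mult stable_approx_def)
  qed (measurable, rule stable_approx_tendsto[OF \<alpha>])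
  then have "(\<lambda>M. test_form a x b y c \<Lambda> (?h M) + c0)
      \<longlonglongrightarrow> test_form a x b y c \<Lambda> (\<lambda>l. exp (- (l powr \<alpha>))) + c0"
    unfolding test_form_def using \<Lambda> by (intro tendsto_intros stable_approx_tendsto[OF \<alpha>]) auto
  moreover have "0 \<le> test_form a x b y c \<Lambda> (?h M) + c0" for M
    \<comment> \<open>The approximant equals 1 at l = 0, so the constant term stays
      \<open>c0\<close>.\<close>
    using laplace_cone_test_form[OF \<Lambda> \<open>0 \<le> c0\<close> _ pos cone, of "real (Suc M) powr (\<alpha> - 1)" M]
    by (simp add: stable_approx_def)
  ultimately show ?thesis by (auto intro: LIMSEQ_le_const)
qed

section \<open>Two-sided bounds for the fractional heat kernel\<close>

text \<open>This is \<open>gauss_ft u\<close> at a unit vector. By scaling, a general point x and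
  parameter s enter only through u = s/|x|^2, apart from the factor |x|^(-N).\<close>

definition gauss_profile :: "nat \<Rightarrow> real \<Rightarrow> real" where
  "gauss_profile N u = sqrt (pi / u) ^ N * exp (- 1 / (4 * u))"

lemma gauss_ft_eq_profile:
  fixes x :: "'a::euclidean_space"
  assumes "x \<noteq> 0" "0 < s"
  shows "gauss_ft s x = gauss_profile DIM('a) (s * (1 / (norm x)\<^sup>2)) / norm x ^ DIM('a)"
  using assms
  by (simp add: gauss_ft_def gauss_profile_def real_sqrt_divide real_sqrt_mult power_mult_distrib power_divide)

text \<open>Near u = 0 the exponential decays like any power: its Taylor term of degree N+1 cancels
  the singularity u^(-N) and leaves one factor u. For u > 1 the profile is bounded and 1 - exp(-u)
  is at least 1/2.\<close>

lemma gauss_profile_le: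
  obtains C where "0 < C" "\<And>u. 0 < u \<Longrightarrow> gauss_profile N u \<le> C * (1 - exp (- u))"
proof -
  define K where "K = pi ^ N * 4 ^ Suc N * fact (Suc N)"
  have K: "0 < K" by (simp add: K_def)
  \<comment> \<open>The two summands are the constants for u at most 1 and u > 1.\<close>
  let ?C = "2 * K + 2 * sqrt pi ^ N"
  have "gauss_profile N u \<le> ?C * (1 - exp (- u))" if u: "0 < u" for u
  proof (cases "u \<le> 1")
    case True
    have pi: "1 \<le> pi" using pi_ge_two by linarith
    have "(1 / (4 * u)) ^ Suc N / fact (Suc N) \<le> exp (1 / (4 * u))"
    proof -
      let ?v = "1 / (4 * u)"
      have "?v ^ Suc N / fact (Suc N) \<le> (\<Sum>k<Suc (Suc N). ?v ^ k / fact k)"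
        using u by (intro member_le_sum) auto
      also have "\<dots> \<le> exp ?v"
        using exp_converges[of ?v] u by (intro sum_le_sums) (auto simp: scaleR_conv_of_real field_simps)
      finally show ?thesis .
    qed
    then have "exp (- (1 / (4 * u))) \<le> inverse ((1 / (4 * u)) ^ Suc N / fact (Suc N))"
      unfolding exp_minus using u by (intro le_imp_inverse_le) auto
    also have "\<dots> = 4 ^ Suc N * fact (Suc N) * u ^ Suc N"
      by (simp add: field_simps power_mult_distrib)
    finally have e: "exp (- 1 / (4 * u)) \<le> 4 ^ Suc N * fact (Suc N) * u ^ Suc N" by simp
    \<comment> \<open>Since this ratio is at least 1, the square root may be dropped, which avoids
      half-integer powers.\<close>
    have "1 \<le> pi / u" using True u pi by (simp add: field_simps)
    then have "sqrt (pi / u) \<le> pi / u"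
      using mult_left_mono[of 1 "pi / u" "pi / u"] by (intro real_le_lsqrt) (simp_all only: power2_eq_square, auto)
    then have "gauss_profile N u \<le> (pi / u) ^ N * (4 ^ Suc N * fact (Suc N) * u ^ Suc N)"
      unfolding gauss_profile_def using e u by (intro mult_mono power_mono) auto
    also have "\<dots> = K * u" using u by (simp add: K_def field_simps)
    also have "\<dots> \<le> K * (2 * (1 - exp (- u)))"
      using half_le_one_minus_exp[of u] u True K by (intro mult_left_mono) auto
    also have "\<dots> \<le> ?C * (1 - exp (- u))"
      using u by (simp add: algebra_simps)
    finally show ?thesis .
  next
    case False
    have "sqrt (pi / u) \<le> sqrt pi" using False by (simp add: field_simps)
    then have "gauss_profile N u \<le> sqrt pi ^ N * 1"
      unfolding gauss_profile_def using u by (intro mult_mono power_mono) auto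
    also have "\<dots> \<le> sqrt pi ^ N * (2 * (1 - exp (- u)))"
      using half_le_one_minus_exp'[of u] False by (intro mult_left_mono) auto
    also have "\<dots> \<le> ?C * (1 - exp (- u))"
      using u K by (simp add: algebra_simps)
    finally show ?thesis .
  qed
  moreover have "0 < ?C" using K by (simp add: add_pos_nonneg)
  ultimately show thesis by (rule that[rotated])
qed

lemma gauss_profile_ge:
  assumes "0 < \<delta>" "0 < A"
  obtains K where "0 < K"
    "\<And>u. 0 < u \<Longrightarrow> 1 - exp (- u) \<le> K * gauss_profile N u + 2 * \<delta> * (1 - exp (- (u / \<delta>))) + 2 * (1 - exp (- (u / A)))"
proof -
  \<comment> \<open>The denominator bounds the profile from below for u between \<delta> and A: the
    root is smallest at A, the exponential at \<delta>. The two error terms cover the remaining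
    u.\<close>
  define K where "K = 1 / (sqrt (pi / A) ^ N * exp (- 1 / (4 * \<delta>)))"
  have K: "0 < K" using assms by (simp add: K_def)
  have "1 - exp (- u) \<le> K * gauss_profile N u + 2 * \<delta> * (1 - exp (- (u / \<delta>))) + 2 * (1 - exp (- (u / A)))"
    if u: "0 < u" for u
  proof -
    have nn: "0 \<le> K * gauss_profile N u" "0 \<le> 2 * \<delta> * (1 - exp (- (u / \<delta>)))" "0 \<le> 2 * (1 - exp (- (u / A)))"
      using u assms K by (auto simp: gauss_profile_def)
    consider "u \<le> \<delta>" | "u \<ge> A" | "\<delta> \<le> u" "u \<le> A" by linarith
    then show ?thesis
    proof cases
      case 1
      have "1 - exp (- u) \<le> u" using exp_ge_add_one_self[of "- u"] by simp
      also have "\<dots> = 2 * \<delta> * (u / \<delta> / 2)" using assms by simp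
      also have "\<dots> \<le> 2 * \<delta> * (1 - exp (- (u / \<delta>)))"
        using assms u 1 by (intro mult_left_mono half_le_one_minus_exp) auto
      finally show ?thesis using nn by linarith
    next
      case 2
      have "1 - exp (- u) \<le> 1" by simp
      also have "\<dots> \<le> 2 * (1 - exp (- (u / A)))"
        using half_le_one_minus_exp'[of "u / A"] 2 assms by simp
      finally show ?thesis using nn by linarith
    next
      case 3
      have "1 - exp (- u) \<le> 1" by simp
      also have "1 = K * (sqrt (pi / A) ^ N * exp (- 1 / (4 * \<delta>)))"
        using assms by (simp add: K_def)
      also have "\<dots> \<le> K * gauss_profile N u"
        unfolding gauss_profile_def using 3 u K assms
        by (intro mult_left_mono mult_mono power_mono real_sqrt_le_mono) (auto simp: field_simps)
      finally show ?thesis using nn by linarith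
    qed
  qed
  with K show thesis by (rule that)
qed

lemma inverse_square_powr:
  fixes r \<alpha> :: real
  assumes "0 < r"
  shows "(1 / r\<^sup>2) powr \<alpha> / r ^ N = r powr (- real N - 2 * \<alpha>)"
proof -
  have "1 / r\<^sup>2 = r powr (- 2)"
    using assms by (simp add: powr_minus_divide)
  then have "(1 / r\<^sup>2) powr \<alpha> / r ^ N = r powr (- 2 * \<alpha>) / r powr real N"
    using assms by (simp add: powr_powr powr_realpow)
  also have "\<dots> = r powr (- 2 * \<alpha> - real N)"
    by (rule powr_diff[symmetric])
  also have "- 2 * \<alpha> - real N = - real N - 2 * \<alpha>"
    by simp
  finally show ?thesis .
qed

section \<open>Bounds for the Fourier transform of the stable profile\<close>

lemma stable_ft_mono:
  fixes x y :: "'a::euclidean_space"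
  assumes \<alpha>: "0 < \<alpha>" "\<alpha> < 1" and "norm x \<le> norm y"
  shows "radial_ft (\<lambda>l. exp (- (l powr \<alpha>))) y \<le> radial_ft (\<lambda>l. exp (- (l powr \<alpha>))) x"
proof -
  have "0 \<le> test_form 1 x (- 1) y (\<lambda>_. 0) {} (\<lambda>l. exp (- (l powr \<alpha>))) + 0"
  proof (rule stable_test_form[OF \<alpha>])
    fix s :: real assume s: "0 < s"
    have "(norm x)\<^sup>2 \<le> (norm y)\<^sup>2" using assms by (intro power_mono) auto
    with s show "0 \<le> test_form 1 x (- 1) y (\<lambda>_. 0) {} (\<lambda>l. exp (- s * l)) + 0"
      unfolding test_form_def radial_ft_exp[OF s]
      by (auto simp: gauss_ft_def intro!: mult_left_mono divide_right_mono)
  qed auto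
  then show ?thesis by (simp add: test_form_def)
qed

lemma stable_ft_upper:
  assumes \<alpha>: "0 < \<alpha>" "\<alpha> < 1"
  obtains C where "0 < C"
    "\<And>x::'a::euclidean_space. x \<noteq> 0 \<Longrightarrow>
       radial_ft (\<lambda>l. exp (- (l powr \<alpha>))) x \<le> C * norm x powr (- real DIM('a) - 2 * \<alpha>)"
proof -
  obtain C where C: "0 < C" "\<And>u. 0 < u \<Longrightarrow> gauss_profile DIM('a) u \<le> C * (1 - exp (- u))"
    using gauss_profile_le[of "DIM('a)"] by blast
  have "radial_ft (\<lambda>l. exp (- (l powr \<alpha>))) x \<le> C * norm x powr (- real DIM('a) - 2 * \<alpha>)"
    if x: "x \<noteq> 0" for x :: 'a
  proof -
    let ?k = "C / norm x ^ DIM('a)" and ?l = "1 / (norm x)\<^sup>2"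
    \<comment> \<open>This encodes \<open>gauss_ft s x \<le> ?k * (1 - exp (- s * ?l))\<close>: the
      1 becomes the constant term, the exponential a point evaluation at \<open>?l\<close>, and the
      second Fourier term is switched off.\<close>
    have "0 \<le> test_form (- 1) x 0 x (\<lambda>_. - ?k) {?l} (\<lambda>l. exp (- (l powr \<alpha>))) + ?k"
    proof (rule stable_test_form[OF \<alpha>])
      fix s :: real assume s: "0 < s"
      have "gauss_ft s x \<le> C * (1 - exp (- (s * ?l))) / norm x ^ DIM('a)"
        unfolding gauss_ft_eq_profile[OF x s] using x s by (intro divide_right_mono C) auto
      then show "0 \<le> test_form (- 1) x 0 x (\<lambda>_. - ?k) {?l} (\<lambda>l. exp (- s * l)) + ?k"
        unfolding test_form_def radial_ft_exp[OF s] by (simp add: algebra_simps diff_divide_distrib)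
    qed (use x C in auto)
    then have "radial_ft (\<lambda>l. exp (- (l powr \<alpha>))) x \<le> ?k * (1 - exp (- (?l powr \<alpha>)))"
      by (simp add: test_form_def algebra_simps)
    also have "\<dots> \<le> ?k * ?l powr \<alpha>"
      using C x exp_ge_add_one_self[of "- (?l powr \<alpha>)"] by (intro mult_left_mono) auto
    also have "?k * ?l powr \<alpha> = C * norm x powr (- real DIM('a) - 2 * \<alpha>)"
      using x by (subst inverse_square_powr[symmetric]) auto
    finally show ?thesis .
  qed
  with C(1) show thesis by (rule that)
qed

text \<open>After the transfer of \<open>gauss_profile_ge\<close> at l = |x|^(-2), the main term is
  at least l^\<alpha>/2 because l is at most 1, while the errors 2 \<delta>^(1-\<alpha>) l^\<alpha>
  and 2 A^(-\<alpha>) l^\<alpha> add up to l^\<alpha>/4.\<close>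

lemma stable_ft_lower:
  assumes \<alpha>: "0 < \<alpha>" "\<alpha> < 1"
  obtains c where "0 < c"
    "\<And>x::'a::euclidean_space. 1 \<le> norm x \<Longrightarrow>
       c * norm x powr (- real DIM('a) - 2 * \<alpha>) \<le> radial_ft (\<lambda>l. exp (- (l powr \<alpha>))) x"
proof -
  (* The scales are chosen such that 2 delta^(1-alpha) = 2 A^(-alpha) = 1/8, so that the two error
     terms of gauss_profile_ge absorb only half of the main term. *)
  define \<delta> A :: real where "\<delta> = (1 / 16) powr (1 / (1 - \<alpha>))" and "A = 16 powr (1 / \<alpha>)"
  have "\<delta> < 1"
    using \<alpha> powr_less_mono2[of "1 / (1 - \<alpha>)" "1 / 16" 1] by (simp add: \<delta>_def)
  moreover have "1 < A"
    using \<alpha> by (simp add: A_def)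
  moreover have "0 < \<delta>" by (simp add: \<delta>_def)
  ultimately have dA: "0 < \<delta>" "\<delta> < 1" "1 < A" "0 < A" by auto
  have d: "\<delta> powr (1 - \<alpha>) = 1 / 16" and A: "A powr \<alpha> = 16"
    using \<alpha> by (simp_all add: \<delta>_def A_def powr_powr)
  obtain K where K: "0 < K"
    "\<And>u. 0 < u \<Longrightarrow> 1 - exp (- u) \<le> K * gauss_profile DIM('a) u + 2 * \<delta> * (1 - exp (- (u / \<delta>))) + 2 * (1 - exp (- (u / A)))"
    using gauss_profile_ge[OF dA(1,4), of "DIM('a)"] by blast
  have "1 / (4 * K) * norm x powr (- real DIM('a) - 2 * \<alpha>) \<le> radial_ft (\<lambda>l. exp (- (l powr \<alpha>))) x"
    if x1: "1 \<le> norm x" for x :: 'a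
  proof -
    have x: "x \<noteq> 0" using x1 by auto
    let ?k = "K * norm x ^ DIM('a)"
    define l where "l = 1 / (norm x)\<^sup>2"
    have l: "0 < l" "l \<le> 1"
      using x x1 by (auto simp: l_def)
    \<comment> \<open>The coefficients are assigned by comparing points, so the three points must be
      distinct for the sum to have its three intended terms.\<close>
    have ne: "l \<noteq> l / \<delta>" "l \<noteq> l / A" "l / \<delta> \<noteq> l / A"
      using dA l by (auto simp: field_simps)
    let ?c = "\<lambda>u. if u = l then 1 else if u = l / \<delta> then - 2 * \<delta> else - 2 :: real"
    have sum: "(\<Sum>u\<in>{l, l / \<delta>, l / A}. ?c u * g u) = g l - 2 * \<delta> * g (l / \<delta>) - 2 * g (l / A)" for g
      using ne by simp
    \<comment> \<open>The constants 2\<delta>, 2 and -1 of \<open>gauss_profile_ge\<close> collect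
      to 2\<delta> + 1.\<close>
    have "0 \<le> test_form ?k x 0 x ?c {l, l / \<delta>, l / A} (\<lambda>l. exp (- (l powr \<alpha>))) + (2 * \<delta> + 1)"
    proof (rule stable_test_form[OF \<alpha>])
      fix s :: real assume s: "0 < s"
      have eq: "?k * gauss_ft s x = K * gauss_profile DIM('a) (s * l)"
        unfolding gauss_ft_eq_profile[OF x s] l_def using x by simp
      from K(2)[of "s * l"] s l show "0 \<le> test_form ?k x 0 x ?c {l, l / \<delta>, l / A} (\<lambda>l. exp (- s * l)) + (2 * \<delta> + 1)"
        unfolding test_form_def radial_ft_exp[OF s] sum eq by (simp add: algebra_simps)
    qed (use l dA in auto)
    then have "1 - exp (- (l powr \<alpha>)) \<le> ?k * radial_ft (\<lambda>l. exp (- (l powr \<alpha>))) x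
        + 2 * \<delta> * (1 - exp (- ((l / \<delta>) powr \<alpha>))) + 2 * (1 - exp (- ((l / A) powr \<alpha>)))"
      unfolding test_form_def sum by (simp add: algebra_simps)
    also have "\<dots> \<le> ?k * radial_ft (\<lambda>l. exp (- (l powr \<alpha>))) x
        + 2 * \<delta> * (l / \<delta>) powr \<alpha> + 2 * (l / A) powr \<alpha>"
      using dA exp_ge_add_one_self[of "- ((l / \<delta>) powr \<alpha>)"] exp_ge_add_one_self[of "- ((l / A) powr \<alpha>)"]
      by (intro add_mono mult_left_mono order.refl) auto
    also have "2 * \<delta> * (l / \<delta>) powr \<alpha> = 2 * \<delta> powr (1 - \<alpha>) * l powr \<alpha>"
      using dA l by (simp add: powr_divide powr_diff)
    also have "2 * (l / A) powr \<alpha> = 1 / 8 * l powr \<alpha>"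
      using dA l A by (simp add: powr_divide)
    finally have "1 - exp (- (l powr \<alpha>)) \<le> ?k * radial_ft (\<lambda>l. exp (- (l powr \<alpha>))) x + l powr \<alpha> / 4"
      unfolding d by simp
    moreover have "l powr \<alpha> \<le> 1"
      using powr_mono2[of \<alpha> l 1] l \<alpha> by simp
    then have "l powr \<alpha> / 2 \<le> 1 - exp (- (l powr \<alpha>))"
      by (intro half_le_one_minus_exp) auto
    ultimately have "l powr \<alpha> / 4 \<le> ?k * radial_ft (\<lambda>l. exp (- (l powr \<alpha>))) x" by simp
    moreover have "0 < ?k" using K x by simp
    ultimately have "l powr \<alpha> / 4 / ?k \<le> radial_ft (\<lambda>l. exp (- (l powr \<alpha>))) x"
      by (simp add: field_simps)
    also have "l powr \<alpha> / 4 / ?k = 1 / (4 * K) * norm x powr (- real DIM('a) - 2 * \<alpha>)"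
      using x by (subst inverse_square_powr[symmetric]) (auto simp: l_def)
    finally show ?thesis .
  qed
  with K(1) show thesis by (intro that[of "1 / (4 * K)"]) auto
qed

section \<open>The fractional heat kernel at time 1\<close>

lemma integrable_fourier_heat:
  fixes x :: "'a::euclidean_space"
  assumes "0 < \<theta>" "0 < t"
  shows "integrable lborel (\<lambda>\<xi>. exp (\<i> * complex_of_real (x \<bullet> \<xi>)) * complex_of_real (exp (- t * norm \<xi> powr \<theta>)))"
proof (rule Bochner_Integration.integrable_bound)
  show "integrable lborel (\<lambda>\<xi>::'a. exp (- t * norm \<xi> powr \<theta>))"
    using assms by (intro integrable_exp_norm_powr)
qed (auto simp: norm_mult)

lemma P_frac_eq_radial_ft:
  fixes x :: "'a::euclidean_space"
  assumes "0 < \<theta>"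
  shows "P_frac \<theta> x 1 = radial_ft (\<lambda>l. exp (- (l powr (\<theta> / 2)))) x / (2 * pi) ^ DIM('a)"
proof -
  have "Re (fourier_heat \<theta> x 1) = (LINT \<xi>|lborel. Re (exp (\<i> * complex_of_real (x \<bullet> \<xi>)) * complex_of_real (exp (- 1 * norm \<xi> powr \<theta>))))"
    unfolding fourier_heat_def using assms by (intro integral_Re[symmetric] integrable_fourier_heat) auto
  also have "\<dots> = radial_ft (\<lambda>l. exp (- (l powr (\<theta> / 2)))) x"
    unfolding radial_ft_def
  proof (intro Bochner_Integration.integral_cong refl)
    fix \<xi> :: 'a
    have "(norm \<xi>)\<^sup>2 powr (\<theta> / 2) = norm \<xi> powr \<theta>"
      by (cases "\<xi> = 0") (simp_all add: powr_numeral[symmetric] powr_powr del: powr_numeral)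
    then show "Re (exp (\<i> * complex_of_real (x \<bullet> \<xi>)) * complex_of_real (exp (- 1 * norm \<xi> powr \<theta>)))
        = cos (x \<bullet> \<xi>) * exp (- ((norm \<xi>)\<^sup>2 powr (\<theta> / 2)))"
      by (simp add: Re_exp)
  qed
  finally show ?thesis by (simp add: P_frac_def)
qed

text \<open>Outside the unit ball the power bounds apply, |x| and 1 + |x| being comparable there.
  Inside it, radial monotonicity places the value between those at a unit vector and at the
  origin.\<close>

lemma P_frac_bounds:
  assumes \<theta>: "0 < \<theta>" "\<theta> < 2"
  obtains c C where "0 < c" "0 < C"
    "\<And>x::'a::euclidean_space. c * (1 + norm x) powr (- real DIM('a) - \<theta>) \<le> P_frac \<theta> x 1"
    "\<And>x::'a. P_frac \<theta> x 1 \<le> C * (1 + norm x) powr (- real DIM('a) - \<theta>)"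
proof -
  let ?p = "- real DIM('a) - \<theta>" and ?D = "(2 * pi) ^ DIM('a)"
  have \<alpha>: "0 < \<theta> / 2" "\<theta> / 2 < 1" using \<theta> by auto
  have p: "- real DIM('a) - 2 * (\<theta> / 2) = ?p" "?p \<le> 0" using \<theta> by auto
  let ?R = "\<lambda>x::'a. radial_ft (\<lambda>l. exp (- (l powr (\<theta> / 2)))) x"
  obtain c where c: "0 < c" "\<And>x::'a. 1 \<le> norm x \<Longrightarrow> c * norm x powr ?p \<le> ?R x"
    using stable_ft_lower[OF \<alpha>, where ?'a='a] unfolding p(1) by blast
  obtain C where C: "0 < C" "\<And>x::'a. x \<noteq> 0 \<Longrightarrow> ?R x \<le> C * norm x powr ?p"
    using stable_ft_upper[OF \<alpha>, where ?'a='a] unfolding p(1) by blast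
  obtain e :: 'a where e: "e \<in> Basis" using nonempty_Basis by blast
  have lower: "c * (1 + norm x) powr ?p \<le> ?R x" for x :: 'a
  proof (cases "1 \<le> norm x")
    case True
    have "c * (1 + norm x) powr ?p \<le> c * norm x powr ?p"
      using True c p by (intro mult_left_mono powr_mono2') auto
    with c(2)[OF True] show ?thesis by linarith
  next
    case False
    have "c * (1 + norm x) powr ?p \<le> c * 1 powr ?p"
      using c p by (intro mult_left_mono powr_mono2') auto
    also have "\<dots> \<le> ?R e" using c(2)[of e] e by simp
    also have "\<dots> \<le> ?R x" using False e by (intro stable_ft_mono \<alpha>) auto
    finally show ?thesis .
  qed
  have two: "2 powr (- ?p) * 2 powr ?p = (1::real)"
    by (simp only: powr_add[symmetric]) simp
  \<comment> \<open>The power of 2 pays for 1 + |x| being at most 2 max(1, |x|); the absolute value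
    spares a proof that \<open>?R 0\<close> is nonnegative.\<close>
  let ?C = "(C + \<bar>?R 0\<bar>) * 2 powr (- ?p)"
  have upper: "?R x \<le> ?C * (1 + norm x) powr ?p" for x :: 'a
  proof (cases "1 \<le> norm x")
    case True
    have "?R x \<le> C * norm x powr ?p" using True by (intro C) auto
    also have "\<dots> = C * (2 powr (- ?p) * 2 powr ?p) * norm x powr ?p"
      by (simp only: two mult_1_right)
    also have "\<dots> = C * 2 powr (- ?p) * (2 * norm x) powr ?p"
      by (simp only: powr_mult mult.assoc)
    also have "\<dots> \<le> C * 2 powr (- ?p) * (1 + norm x) powr ?p"
      using True C p by (intro mult_left_mono powr_mono2') (auto intro!: add_pos_nonneg)
    also have "\<dots> \<le> ?C * (1 + norm x) powr ?p"
      by (intro mult_right_mono) auto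
    finally show ?thesis .
  next
    case False
    have "?R x \<le> ?R 0" by (intro stable_ft_mono \<alpha>) auto
    also have "\<dots> \<le> (C + \<bar>?R 0\<bar>) * 2 powr (- ?p) * 2 powr ?p"
      using C two by (simp add: mult.assoc)
    also have "\<dots> \<le> ?C * (1 + norm x) powr ?p"
      using False C p by (intro mult_left_mono powr_mono2') (auto intro!: add_pos_nonneg)
    finally show ?thesis .
  qed
  show thesis
  proof (rule that)
    show "0 < c / ?D" "0 < ?C / ?D" using c C by (auto intro!: mult_pos_pos add_pos_nonneg)
    show "c / ?D * (1 + norm x) powr ?p \<le> P_frac \<theta> x 1" for x :: 'a
      using divide_right_mono[OF lower[of x], of ?D] by (simp add: P_frac_eq_radial_ft[OF \<theta>(1)])
    show "P_frac \<theta> x 1 \<le> ?C / ?D * (1 + norm x) powr ?p" for x :: 'a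
      using divide_right_mono[OF upper[of x], of ?D] by (simp add: P_frac_eq_radial_ft[OF \<theta>(1)])
  qed
qed

section \<open>Kernel comparison and convolution\<close>

text \<open>The function h_r of the overview; dividing by r^N makes its integral independent of
  r.\<close>

definition bracket_kernel :: "real \<Rightarrow> real \<Rightarrow> 'a::euclidean_space \<Rightarrow> real" where
  "bracket_kernel \<theta> r x = (1 + norm x / r) powr (- real DIM('a) - \<theta>) / r ^ DIM('a)"

lemma bracket_kernel_nonneg: "0 < r \<Longrightarrow> 0 \<le> bracket_kernel \<theta> r x"
  by (simp add: bracket_kernel_def)

section \<open>Scaling and comparison with the bracket kernel\<close>

lemma P_frac_scale:
  fixes x :: "'a::euclidean_space"
  assumes "0 < r"
  shows "P_frac \<theta> x (r powr \<theta>) = P_frac \<theta> (x /\<^sub>R r) 1 / r ^ DIM('a)"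
proof -
  let ?f = "\<lambda>\<xi>. exp (\<i> * complex_of_real ((x /\<^sub>R r) \<bullet> \<xi>)) * complex_of_real (exp (- 1 * norm \<xi> powr \<theta>))"
  have inner: "(x /\<^sub>R r) \<bullet> (0 + r *\<^sub>R \<xi>) = x \<bullet> \<xi>" for \<xi>
    using assms by simp
  have "fourier_heat \<theta> (x /\<^sub>R r) 1 = \<bar>r\<bar> ^ DIM('a) *\<^sub>R (LINT \<xi>|lborel. ?f (0 + r *\<^sub>R \<xi>))"
    unfolding fourier_heat_def using assms by (intro integral_lborel_affine) auto
  also have "(LINT \<xi>|lborel. ?f (0 + r *\<^sub>R \<xi>)) = fourier_heat \<theta> x (r powr \<theta>)"
    unfolding fourier_heat_def inner using assms
    by (intro Bochner_Integration.integral_cong refl) (simp add: powr_mult)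
  finally show ?thesis using assms by (simp add: P_frac_def)
qed

lemma K_frac_eq:
  fixes x :: "'a::euclidean_space"
  assumes "0 < t"
  shows "K_frac \<theta> d x t = P_frac \<theta> (x /\<^sub>R (t powr (1 / d))) 1 / (t powr (1 / d)) ^ DIM('a)"
  unfolding K_frac_def using P_frac_scale[of "t powr (1 / d)" \<theta> x] assms by (simp add: powr_powr)

lemma K_frac_bounds:
  assumes \<theta>: "0 < \<theta>" "\<theta> < 2"
  obtains c C where "0 < c" "0 < C"
    "\<And>(x::'a::euclidean_space) t. 0 < t \<Longrightarrow> c * bracket_kernel \<theta> (t powr (1 / d)) x \<le> K_frac \<theta> d x t"
    "\<And>(x::'a) t. 0 < t \<Longrightarrow> K_frac \<theta> d x t \<le> C * bracket_kernel \<theta> (t powr (1 / d)) x"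
proof -
  obtain c C where cC: "0 < c" "0 < C"
    "\<And>x::'a. c * (1 + norm x) powr (- real DIM('a) - \<theta>) \<le> P_frac \<theta> x 1"
    "\<And>x::'a. P_frac \<theta> x 1 \<le> C * (1 + norm x) powr (- real DIM('a) - \<theta>)"
    using P_frac_bounds[OF \<theta>, where ?'a='a] by blast
  show thesis
  proof (rule that[OF cC(1,2)])
    fix x :: 'a and t :: real assume t: "0 < t"
    let ?r = "t powr (1 / d)"
    have r: "0 < ?r" using t by simp
    have n: "norm (x /\<^sub>R ?r) = norm x / ?r" using r by (simp add: divide_inverse mult.commute)
    have "c * (1 + norm x / ?r) powr (- real DIM('a) - \<theta>) / ?r ^ DIM('a) \<le> P_frac \<theta> (x /\<^sub>R ?r) 1 / ?r ^ DIM('a)"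
      using cC(3)[of "x /\<^sub>R ?r"] r unfolding n by (intro divide_right_mono) auto
    then show "c * bracket_kernel \<theta> ?r x \<le> K_frac \<theta> d x t"
      unfolding K_frac_eq[OF t] bracket_kernel_def by simp
    have "P_frac \<theta> (x /\<^sub>R ?r) 1 / ?r ^ DIM('a) \<le> C * (1 + norm x / ?r) powr (- real DIM('a) - \<theta>) / ?r ^ DIM('a)"
      using cC(4)[of "x /\<^sub>R ?r"] r unfolding n by (intro divide_right_mono) auto
    then show "K_frac \<theta> d x t \<le> C * bracket_kernel \<theta> ?r x"
      unfolding K_frac_eq[OF t] bracket_kernel_def by simp
  qed
qed

lemma borel_measurable_K_frac: "(\<lambda>x::'a::euclidean_space. K_frac \<theta> d x t) \<in> borel_measurable borel"
  unfolding K_frac_def P_frac_def fourier_heat_def by measurable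

lemma bracket_kernel_translate:
  fixes x :: "'a::euclidean_space"
  assumes "0 < r" "0 < \<theta>"
  shows integrable_bracket_kernel: "integrable lborel (\<lambda>y. bracket_kernel \<theta> r (x - y))"
    and integral_bracket_kernel:
      "(LINT y|lborel. bracket_kernel \<theta> r (x - y)) = (LINT y|lborel. bracket_kernel \<theta> 1 (y::'a))"
proof -
  have b: "integrable lborel (bracket_kernel \<theta> 1 :: 'a \<Rightarrow> real)"
    using integrable_bracket[OF assms(2), where ?'a='a] by (simp add: bracket_kernel_def[abs_def])
  have eq: "bracket_kernel \<theta> r (x - y) = bracket_kernel \<theta> 1 (x /\<^sub>R r + (- 1 / r) *\<^sub>R y) / r ^ DIM('a)" for y
  proof -
    have "x /\<^sub>R r + (- 1 / r) *\<^sub>R y = (x - y) /\<^sub>R r"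
      by (simp add: algebra_simps divide_inverse)
    then show ?thesis
      using assms(1) by (simp add: bracket_kernel_def divide_inverse mult.commute)
  qed
  show "integrable lborel (\<lambda>y. bracket_kernel \<theta> r (x - y))"
    unfolding eq using assms by (intro integrable_divide integrable_lborel_affine b) auto
  have "(LINT y|lborel. bracket_kernel \<theta> 1 (y::'a)) = \<bar>- 1 / r\<bar> ^ DIM('a) *\<^sub>R
      (LINT y|lborel. bracket_kernel \<theta> 1 (x /\<^sub>R r + (- 1 / r) *\<^sub>R y))"
    using assms b by (intro integral_lborel_affine) auto
  then show "(LINT y|lborel. bracket_kernel \<theta> r (x - y)) = (LINT y|lborel. bracket_kernel \<theta> 1 (y::'a))"
    unfolding eq using assms(1) by (simp add: power_divide)
qed

section \<open>The pointwise product inequality\<close>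

lemma bracket_kernel_far:
  fixes u x :: "'a::euclidean_space"
  assumes "0 < r" "r \<le> R" "R \<le> norm x" "norm x \<le> 2 * norm u" "0 < \<theta>"
  shows "bracket_kernel \<theta> r u \<le> 4 powr (real DIM('a) + \<theta>) * bracket_kernel \<theta> R x"
proof -
  let ?N = "real DIM('a)"
  let ?p = "- ?N - \<theta>"
  have pos: "0 < R" "0 < norm x" "0 < norm u" using assms by linarith+
  have scale: "(z / s) powr ?p / s ^ DIM('a) = z powr ?p * s powr \<theta>" if "0 < z" "0 < s" for z s :: real
  proof -
    have "(z / s) powr ?p / s ^ DIM('a) = z powr ?p / (s powr ?p * s powr ?N)"
      using that by (simp add: powr_divide powr_realpow)
    also have "s powr ?p * s powr ?N = s powr (- \<theta>)"
      by (simp add: powr_add[symmetric])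
    finally show ?thesis by (simp add: powr_minus divide_inverse)
  qed
  \<comment> \<open>Without the summand 1 the kernel is r^\<theta> |u|^(-N-\<theta>), increasing in
    r and decreasing in |u|. One factor 2 is lost in passing from |u| to |x|, another in 1 + |x|/R
    being at most 2|x|/R; together they give the base 4.\<close>
  have "bracket_kernel \<theta> r u \<le> (norm u / r) powr ?p / r ^ DIM('a)"
    unfolding bracket_kernel_def using assms pos by (intro divide_right_mono powr_mono2') auto
  also have "\<dots> = norm u powr ?p * r powr \<theta>"
    using assms pos by (intro scale)
  also have "\<dots> \<le> (norm x / 2) powr ?p * R powr \<theta>"
    using assms pos by (intro mult_mono powr_mono2' powr_mono2) auto
  also have "(norm x / 2) powr ?p = 4 powr (?N + \<theta>) * (2 * norm x) powr ?p"
  proof -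
    have "(norm x / 2) powr ?p = ((1 / 4) * (2 * norm x)) powr ?p" by simp
    also have "\<dots> = (1 / 4) powr ?p * (2 * norm x) powr ?p" by (rule powr_mult)
    also have "(1 / 4) powr ?p = (4 :: real) powr (?N + \<theta>)"
      by (simp add: powr_divide powr_minus_divide[symmetric] add.commute)
    finally show ?thesis by simp
  qed
  also have "4 powr (?N + \<theta>) * (2 * norm x) powr ?p * R powr \<theta>
      = 4 powr (?N + \<theta>) * ((2 * norm x / R) powr ?p / R ^ DIM('a))"
    using pos by (subst scale) auto
  also have "\<dots> \<le> 4 powr (?N + \<theta>) * bracket_kernel \<theta> R x"
    unfolding bracket_kernel_def using assms pos
    by (intro mult_left_mono divide_right_mono powr_mono2') (auto simp: field_simps add_pos_pos)
  finally show ?thesis .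
qed

text \<open>The left kernel never exceeds r^(-N), and on the ball of radius R the right kernel is at
  least 2^(-N-\<theta>) R^(-N).\<close>

lemma bracket_kernel_near:
  fixes u x :: "'a::euclidean_space"
  assumes "0 < \<kappa>" "0 < R" "\<kappa> * R \<le> r" "norm x \<le> R" "0 < \<theta>"
  shows "bracket_kernel \<theta> r u \<le> 2 powr (real DIM('a) + \<theta>) / \<kappa> ^ DIM('a) * bracket_kernel \<theta> R x"
proof -
  let ?N = "real DIM('a)"
  let ?p = "- ?N - \<theta>"
  have r: "0 < \<kappa> * R" "0 < r" using assms mult_pos_pos[of \<kappa> R] by linarith+
  have "bracket_kernel \<theta> r u \<le> 1 powr ?p / r ^ DIM('a)"
    unfolding bracket_kernel_def using assms r by (intro divide_right_mono powr_mono2') auto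
  also have "\<dots> \<le> 1 / (\<kappa> * R) ^ DIM('a)"
    using r assms by (simp, intro divide_left_mono power_mono mult_pos_pos) auto
  also have "\<dots> = 2 powr (?N + \<theta>) / \<kappa> ^ DIM('a) * (2 powr ?p / R ^ DIM('a))"
  proof -
    have "2 powr (?N + \<theta>) * 2 powr ?p = (1::real)"
      by (simp add: powr_add[symmetric])
    then show ?thesis by (simp add: power_mult_distrib)
  qed
  also have "\<dots> \<le> 2 powr (?N + \<theta>) / \<kappa> ^ DIM('a) * bracket_kernel \<theta> R x"
    unfolding bracket_kernel_def using assms
    by (intro mult_left_mono divide_right_mono powr_mono2') (auto intro: add_pos_nonneg)
  finally show ?thesis .
qed

text \<open>One of the two factors is at most M h_R(u+v), and the other is at most the sum. If |u+v|
  is at most R, it is the factor whose scale is comparable to R; otherwise the one whose argument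
  has norm at least |u+v|/2.\<close>

lemma bracket_kernel_mult_le:
  fixes u v :: "'a::euclidean_space"
  assumes rq: "0 < r" "r \<le> R" "0 < q" "q \<le> R" and \<kappa>: "0 < \<kappa>" "\<kappa> * R \<le> r \<or> \<kappa> * R \<le> q" and "0 < \<theta>"
  defines "M \<equiv> 4 powr (real DIM('a) + \<theta>) + 2 powr (real DIM('a) + \<theta>) / \<kappa> ^ DIM('a)"
  shows "bracket_kernel \<theta> r u * bracket_kernel \<theta> q v
    \<le> M * bracket_kernel \<theta> R (u + v) * (bracket_kernel \<theta> r u + bracket_kernel \<theta> q v)"
proof -
  let ?H = "bracket_kernel \<theta> R (u + v)"
  have R: "0 < R" using rq by linarith
  have nn: "0 \<le> bracket_kernel \<theta> r u" "0 \<le> bracket_kernel \<theta> q v" "0 \<le> ?H" "0 \<le> M"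
    using rq R \<kappa> by (auto simp: bracket_kernel_nonneg M_def)
  have M: "4 powr (real DIM('a) + \<theta>) * ?H \<le> M * ?H" "2 powr (real DIM('a) + \<theta>) / \<kappa> ^ DIM('a) * ?H \<le> M * ?H"
    unfolding M_def using nn(3) \<kappa>(1) by (intro mult_right_mono; simp)+
  have "bracket_kernel \<theta> r u \<le> M * ?H \<or> bracket_kernel \<theta> q v \<le> M * ?H"
  proof (cases "norm (u + v) \<le> R")
    case True
    from \<kappa>(2) show ?thesis
    proof
      assume "\<kappa> * R \<le> r"
      from bracket_kernel_near[OF \<kappa>(1) R this True \<open>0 < \<theta>\<close>, of u] M(2) show ?thesis by linarith
    next
      assume "\<kappa> * R \<le> q"
      from bracket_kernel_near[OF \<kappa>(1) R this True \<open>0 < \<theta>\<close>, of v] M(2) show ?thesis by linarith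
    qed
  next
    case False
    then have F: "R \<le> norm (u + v)" by simp
    have "norm (u + v) \<le> 2 * norm u \<or> norm (u + v) \<le> 2 * norm v"
      using norm_triangle_ineq[of u v] by linarith
    then show ?thesis
    proof
      assume "norm (u + v) \<le> 2 * norm u"
      from bracket_kernel_far[OF rq(1,2) F this \<open>0 < \<theta>\<close>] M(1) show ?thesis by linarith
    next
      assume "norm (u + v) \<le> 2 * norm v"
      from bracket_kernel_far[OF rq(3,4) F this \<open>0 < \<theta>\<close>] M(1) show ?thesis by linarith
    qed
  qed
  then show ?thesis
  proof
    assume *: "bracket_kernel \<theta> r u \<le> M * ?H"
    have "bracket_kernel \<theta> r u * bracket_kernel \<theta> q v \<le> M * ?H * bracket_kernel \<theta> q v"
      using * nn by (intro mult_right_mono)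
    also have "\<dots> \<le> M * ?H * (bracket_kernel \<theta> r u + bracket_kernel \<theta> q v)"
      using nn by (intro mult_left_mono) auto
    finally show ?thesis .
  next
    assume *: "bracket_kernel \<theta> q v \<le> M * ?H"
    have "bracket_kernel \<theta> r u * bracket_kernel \<theta> q v \<le> bracket_kernel \<theta> r u * (M * ?H)"
      using * nn by (intro mult_left_mono)
    also have "\<dots> = M * ?H * bracket_kernel \<theta> r u"
      by simp
    also have "\<dots> \<le> M * ?H * (bracket_kernel \<theta> r u + bracket_kernel \<theta> q v)"
      using nn by (intro mult_left_mono) auto
    finally show ?thesis .
  qed
qed

section \<open>The convolution estimate and the kernel comparison\<close>

lemma K_frac_convolution:
  assumes \<theta>: "0 < \<theta>" "\<theta> < 2" and d: "0 < d"
  obtains C where "0 < C"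
    "\<And>(x::'a::euclidean_space) s t. 0 < s \<Longrightarrow> s < t \<Longrightarrow>
       integrable lborel (\<lambda>y. K_frac \<theta> d (x - y) (t - s) * K_frac \<theta> d y s)"
    "\<And>(x::'a) s t. 0 < s \<Longrightarrow> s < t \<Longrightarrow>
       (LINT y|lborel. K_frac \<theta> d (x - y) (t - s) * K_frac \<theta> d y s) \<le> C * K_frac \<theta> d x t"
proof -
  obtain c C where cC: "0 < c" "0 < C"
    "\<And>(x::'a) t. 0 < t \<Longrightarrow> c * bracket_kernel \<theta> (t powr (1 / d)) x \<le> K_frac \<theta> d x t"
    "\<And>(x::'a) t. 0 < t \<Longrightarrow> K_frac \<theta> d x t \<le> C * bracket_kernel \<theta> (t powr (1 / d)) x"
    using K_frac_bounds[OF \<theta>, where ?'a='a and d=d] by blast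
  \<comment> \<open>One of s and t-s is at least t/2, so one of the two scales is at least this
    fraction of \<open>t powr (1 / d)\<close>.\<close>
  define \<kappa> :: real where "\<kappa> = (1 / 2) powr (1 / d)"
  define M where "M = 4 powr (real DIM('a) + \<theta>) + 2 powr (real DIM('a) + \<theta>) / \<kappa> ^ DIM('a)"
  define I where "I = (LINT y|lborel. bracket_kernel \<theta> 1 (y::'a))"
  have \<kappa>: "0 < \<kappa>" by (simp add: \<kappa>_def)
  have M: "0 \<le> M" using \<kappa> by (simp add: M_def)
  have I: "0 \<le> I" unfolding I_def by (intro integral_nonneg_AE) (simp add: bracket_kernel_nonneg)
  have main: "integrable lborel (\<lambda>y. K_frac \<theta> d (x - y) (t - s) * K_frac \<theta> d y s) \<and>
      (LINT y|lborel. K_frac \<theta> d (x - y) (t - s) * K_frac \<theta> d y s) \<le> (C\<^sup>2 * M * (2 * I) / c + 1) * K_frac \<theta> d x t"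
    if s: "0 < s" "s < t" for x :: 'a and s t
  proof -
    let ?r = "(t - s) powr (1 / d)" and ?q = "s powr (1 / d)" and ?R = "t powr (1 / d)"
    let ?F = "\<lambda>y. K_frac \<theta> d (x - y) (t - s) * K_frac \<theta> d y s"
    \<comment> \<open>The argument 0 - y, equivalent to y by symmetry, brings the second kernel into
      the translated form of \<open>integrable_bracket_kernel\<close>.\<close>
    let ?G = "\<lambda>y. C\<^sup>2 * M * bracket_kernel \<theta> ?R x * (bracket_kernel \<theta> ?r (x - y) + bracket_kernel \<theta> ?q (0 - y))"
    have ts: "0 < t - s" "0 < t" using s by auto
    have pos: "0 < ?r" "0 < ?q" "0 < ?R" using s by auto
    have le: "?r \<le> ?R" "?q \<le> ?R" using s d by (auto intro!: powr_mono2)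
    have K0: "0 \<le> K_frac \<theta> d y \<tau>" if "0 < \<tau>" for y :: 'a and \<tau>
    proof -
      have "0 \<le> c * bracket_kernel \<theta> (\<tau> powr (1 / d)) y"
        using that cC by (intro mult_nonneg_nonneg bracket_kernel_nonneg) auto
      with cC(3)[OF that, of y] show ?thesis by linarith
    qed
    have "t / 2 \<le> t - s \<or> t / 2 \<le> s" by linarith
    then have "(t / 2) powr (1 / d) \<le> ?r \<or> (t / 2) powr (1 / d) \<le> ?q"
      using s d by (auto intro!: powr_mono2)
    moreover have "(t / 2) powr (1 / d) = \<kappa> * ?R"
      by (simp add: \<kappa>_def powr_mult[symmetric])
    ultimately have \<kappa>R: "\<kappa> * ?R \<le> ?r \<or> \<kappa> * ?R \<le> ?q" by simp
    have sym: "bracket_kernel \<theta> ?q (0 - y) = bracket_kernel \<theta> ?q y" for y :: 'a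
      by (simp add: bracket_kernel_def)
    have FG: "0 \<le> ?F y" "?F y \<le> ?G y" for y
    proof -
      show "0 \<le> ?F y" using s by (intro mult_nonneg_nonneg K0) auto
      have "?F y \<le> (C * bracket_kernel \<theta> ?r (x - y)) * (C * bracket_kernel \<theta> ?q y)"
        using s cC pos by (intro mult_mono cC K0 mult_nonneg_nonneg bracket_kernel_nonneg) auto
      also have "\<dots> = C\<^sup>2 * (bracket_kernel \<theta> ?r (x - y) * bracket_kernel \<theta> ?q y)"
        by (simp add: power2_eq_square)
      also have "\<dots> \<le> C\<^sup>2 * (M * bracket_kernel \<theta> ?R (x - y + y) * (bracket_kernel \<theta> ?r (x - y) + bracket_kernel \<theta> ?q y))"
        unfolding M_def
        by (intro mult_left_mono bracket_kernel_mult_le pos le \<kappa> \<kappa>R \<theta>) auto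
      finally show "?F y \<le> ?G y" unfolding sym by (simp add: mult.assoc)
    qed
    have G: "integrable lborel ?G"
      by (intro integrable_mult_right Bochner_Integration.integrable_add integrable_bracket_kernel pos \<theta>)
    have meas: "?F \<in> borel_measurable lborel"
      using borel_measurable_K_frac[of \<theta> d "t - s", where ?'a='a] borel_measurable_K_frac[of \<theta> d s, where ?'a='a]
      by measurable
    have F: "integrable lborel ?F"
    proof (rule Bochner_Integration.integrable_bound[OF G meas], rule AE_I2)
      show "norm (?F y) \<le> norm (?G y)" for y
        using FG[of y] by (simp only: real_norm_def abs_of_nonneg order.trans[OF FG])
    qed
    have "(LINT y|lborel. ?F y) \<le> (LINT y|lborel. ?G y)"
      by (intro integral_mono F G FG)
    also have "\<dots> = C\<^sup>2 * M * bracket_kernel \<theta> ?R x * (I + I)"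
    proof -
      have "(LINT y|lborel. bracket_kernel \<theta> ?r (x - y) + bracket_kernel \<theta> ?q (0 - y)) = I + I"
        unfolding I_def
        by (subst Bochner_Integration.integral_add)
          (simp_all only: integrable_bracket_kernel integral_bracket_kernel pos \<theta>)
      then show ?thesis by (simp only: integral_mult_right_zero)
    qed
    also have "\<dots> = C\<^sup>2 * M * (2 * I) / c * (c * bracket_kernel \<theta> ?R x)"
      using cC by simp
    also have "\<dots> \<le> C\<^sup>2 * M * (2 * I) / c * K_frac \<theta> d x t"
      using cC M I ts by (intro mult_left_mono cC) auto
    \<comment> \<open>Adding 1 makes the constant positive when only nonnegativity of
      \<open>M\<close> and \<open>I\<close> is at hand.\<close>
    also have "\<dots> \<le> (C\<^sup>2 * M * (2 * I) / c + 1) * K_frac \<theta> d x t"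
      using K0[OF ts(2)] by (intro mult_right_mono) auto
    finally show ?thesis using F by simp
  qed
  show thesis
  proof (rule that)
    show "0 < C\<^sup>2 * M * (2 * I) / c + 1"
      using cC M I by (intro add_nonneg_pos) auto
  qed (use main in blast)+
qed

lemma admissible_kernel_le_K_frac:
  fixes G :: "'a::euclidean_space \<Rightarrow> 'a \<Rightarrow> real \<Rightarrow> real"
  assumes d: "0 < d" and G: "admissible_kernel k d L T G" and \<theta>: "0 < \<theta>" "\<theta> < 2" "\<theta> \<le> L" and "j \<le> k"
  obtains c where "0 < c"
    "\<And>x y t. 0 < t \<Longrightarrow> ereal t < T \<Longrightarrow>
       norm_grad j (\<lambda>x. G x y t) x \<le> c * t powr (- (real j / d)) * K_frac \<theta> d (x - y) t"
proof -
  obtain c C where cC: "0 < c" "0 < C"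
    "\<And>(x::'a) t. 0 < t \<Longrightarrow> c * bracket_kernel \<theta> (t powr (1 / d)) x \<le> K_frac \<theta> d x t"
    "\<And>(x::'a) t. 0 < t \<Longrightarrow> K_frac \<theta> d x t \<le> C * bracket_kernel \<theta> (t powr (1 / d)) x"
    using K_frac_bounds[OF \<theta>(1,2), where ?'a='a and d=d] by blast
  obtain B where B: "0 < B" "\<And>x y t. 0 < t \<Longrightarrow> ereal t < T \<Longrightarrow> norm_grad j (\<lambda>x. G x y t) x
      \<le> B * t powr (- ((real DIM('a) + real j) / d))
          * (1 + t powr (- (1 / d)) * norm (x - y)) powr (- real DIM('a) - L - real j)"
    using G \<open>j \<le> k\<close> unfolding admissible_kernel_def by blast
  have "norm_grad j (\<lambda>x. G x y t) x \<le> B / c * t powr (- (real j / d)) * K_frac \<theta> d (x - y) t"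
    if t: "0 < t" "ereal t < T" for x y t
  proof -
    let ?r = "t powr (1 / d)"
    have r: "0 < ?r" using t by simp
    have "norm_grad j (\<lambda>x. G x y t) x \<le> B * t powr (- ((real DIM('a) + real j) / d))
          * (1 + t powr (- (1 / d)) * norm (x - y)) powr (- real DIM('a) - L - real j)"
      by (rule B(2)[OF t])
    \<comment> \<open>The base is at least 1 and -L-j is at most -\<theta>, so the smaller decay
      exponent only enlarges the bound.\<close>
    also have "\<dots> \<le> B * t powr (- ((real DIM('a) + real j) / d))
          * (1 + t powr (- (1 / d)) * norm (x - y)) powr (- real DIM('a) - \<theta>)"
      using B t \<theta> by (intro mult_left_mono powr_mono) auto
    also have "t powr (- (1 / d)) * norm (x - y) = norm (x - y) / ?r"
      by (simp add: powr_minus divide_inverse mult.commute)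
    also have "t powr (- ((real DIM('a) + real j) / d)) = t powr (- (real j / d)) / ?r ^ DIM('a)"
    proof -
      have "?r ^ DIM('a) = t powr (real DIM('a) / d)"
        using t by (simp add: powr_realpow[symmetric] powr_powr)
      moreover have "- ((real DIM('a) + real j) / d) = - (real j / d) - real DIM('a) / d"
        by (simp add: add_divide_distrib)
      ultimately show ?thesis
        by (simp only: powr_diff)
    qed
    also have "B * (t powr (- (real j / d)) / ?r ^ DIM('a)) * (1 + norm (x - y) / ?r) powr (- real DIM('a) - \<theta>)
        = B / c * t powr (- (real j / d)) * (c * bracket_kernel \<theta> ?r (x - y))"
      using cC by (simp add: bracket_kernel_def)
    also have "\<dots> \<le> B / c * t powr (- (real j / d)) * K_frac \<theta> d (x - y) t"
      using cC B t by (intro mult_left_mono cC) auto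
    finally show ?thesis .
  qed
  moreover have "0 < B / c" using B cC by simp
  ultimately show thesis by (rule that[rotated])
qed

theorem theorem1p1:
  fixes G :: "real ^ 'n \<Rightarrow> real ^ 'n \<Rightarrow> real \<Rightarrow> real"
    and l m :: nat and d L \<theta> :: real and T :: ereal
  assumes "d > real (l + m)" and "L > 0" and "T > 0"
    and "admissible_kernel (l + m) d L T G"
    and "0 < \<theta>" and "\<theta> < 2" and "\<theta> \<le> min d L"
  shows "(\<forall>j\<le>l + m. \<exists>c>0. \<forall>x y t. 0 < t \<and> ereal t < T \<longrightarrow>
            norm_grad j (\<lambda>x. G x y t) x \<le> c * t powr (- (real j / d)) * K_frac \<theta> d (x - y) t)
       \<and> (\<exists>C>0. \<forall>(x :: real ^ 'n) s t. 0 < s \<and> s < t \<longrightarrow>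
            integrable lborel (\<lambda>y. K_frac \<theta> d (x - y) (t - s) * K_frac \<theta> d y s) \<and>
            (LINT y|lborel. K_frac \<theta> d (x - y) (t - s) * K_frac \<theta> d y s) \<le> C * K_frac \<theta> d x t)"
proof (intro conjI allI impI)
  have d: "0 < d" and \<theta>: "\<theta> \<le> L" using assms by auto
  show "\<exists>c>0. \<forall>x y t. 0 < t \<and> ereal t < T \<longrightarrow>
      norm_grad j (\<lambda>x. G x y t) x \<le> c * t powr (- (real j / d)) * K_frac \<theta> d (x - y) t"
    if "j \<le> l + m" for j
    by (rule admissible_kernel_le_K_frac[OF d assms(4,5,6) \<theta> that]) blast
  show "\<exists>C>0. \<forall>(x :: real ^ 'n) s t. 0 < s \<and> s < t \<longrightarrow>
      integrable lborel (\<lambda>y. K_frac \<theta> d (x - y) (t - s) * K_frac \<theta> d y s) \<and>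
      (LINT y|lborel. K_frac \<theta> d (x - y) (t - s) * K_frac \<theta> d y s) \<le> C * K_frac \<theta> d x t"
    by (rule K_frac_convolution[OF assms(5,6) d]) blast
qed

end
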